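(* Let $r,a\in\mathbb{R}$ with $0<r\le\frac12$ and $a\ge r$, and let $\Omega=(0,r)\cup(a,a+1-r)\subset\mathbb{R}$. Suppose that $\Lambda\subset\mathbb{R}$ is a spectrum for $\Omega$ and $0\in\Lambda$. Then at least one of the following holds: (i) $a-r\in\mathbb{Z}$ and $\Lambda=\mathbb{Z}$; (ii) $r=\frac12$, $a=\frac n2$ for some $n\in\mathbb{Z}$, and $\Lambda=2\mathbb{Z}\cup\left(\frac pn+2\mathbb{Z}\right)$ for some odd integer $p$. Conversely, if $\Omega=(0,r)\cup(a,a+1-r)$ with $0<r\le\frac12$, $a\ge r$, $\Lambda\subset\mathbb{R}$, and either (i) or (ii) holds, then $\Lambda$ is a spectrum for $\Omega$.
   Context: For a Borel set $\Omega\subset\mathbb{R}$ of Lebesgue measure $|\Omega|=1$, a set $\Lambda=\{\lambda_k: k\in\mathbb{Z}\}\subset\mathbb{R}$ (with the $\lambda_k$ distinct) is called a spectrum for $\Omega$ if the functions $\{e^{2\pi i\lambda_k x}\}_{k\in\mathbb{Z}}$ form an orthonormal basis for $L^2(\Omega)$. In (ii), the same integer $n$ appears in $a=\frac n2$ and in the formula for $\Lambda$ (it is automatically positive since $a\ge r=\frac12$). *)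

theory Defs
  imports "HOL-Analysis.Analysis"
begin

text \<open>
  $L^2(\Omega)$ is represented by square-integrable functions, not by classes of functions that
  agree almost everywhere; two representatives of one class have \<open>L2_sqdist\<close> equal to 0.
\<close>

definition L2_set_on :: "real set \<Rightarrow> (real \<Rightarrow> complex) set" where
  "L2_set_on \<Omega> = {f. f \<in> borel_measurable (lebesgue_on \<Omega>) \<and>
                      integrable (lebesgue_on \<Omega>) (\<lambda>x. (cmod (f x))\<^sup>2)}"

definition L2_inner :: "real set \<Rightarrow> (real \<Rightarrow> complex) \<Rightarrow> (real \<Rightarrow> complex) \<Rightarrow> complex" where
  "L2_inner \<Omega> f g = (LINT x|lebesgue_on \<Omega>. f x * cnj (g x))"

definition L2_sqdist :: "real set \<Rightarrow> (real \<Rightarrow> complex) \<Rightarrow> (real \<Rightarrow> complex) \<Rightarrow> real" where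
  "L2_sqdist \<Omega> f g = (LINT x|lebesgue_on \<Omega>. (cmod (f x - g x))\<^sup>2)"

text \<open>An orthonormal family whose finite linear combinations are dense in $L^2(\Omega)$.\<close>

definition L2_orthonormal_basis :: "real set \<Rightarrow> ('i \<Rightarrow> real \<Rightarrow> complex) \<Rightarrow> bool" where
  "L2_orthonormal_basis \<Omega> e \<longleftrightarrow>
     (\<forall>k. e k \<in> L2_set_on \<Omega>) \<and>
     (\<forall>j k. L2_inner \<Omega> (e j) (e k) = (if j = k then 1 else 0)) \<and>
     (\<forall>f\<in>L2_set_on \<Omega>. \<forall>\<epsilon>>0. \<exists>K c. finite K \<and>
        L2_sqdist \<Omega> f (\<lambda>x. \<Sum>k\<in>K. c k * e k x) < \<epsilon>)"

definition is_spectrum :: "real set \<Rightarrow> real set \<Rightarrow> bool" where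
  "is_spectrum \<Omega> \<Lambda> \<longleftrightarrow>
     \<Omega> \<in> sets borel \<and> emeasure lborel \<Omega> = 1 \<and>
     (\<exists>\<mu> :: int \<Rightarrow> real. inj \<mu> \<and> \<Lambda> = range \<mu> \<and>
        L2_orthonormal_basis \<Omega>
          (\<lambda>k x. exp (2 * complex_of_real pi * \<i> * complex_of_real (\<mu> k) * complex_of_real x)))"

end

theory Submission
  imports Defs
begin

text \<open>
  Write $e_\nu(x) = e^{2\pi i\nu x}$. The set $\Omega$ and a frequency $\nu \ne 0$ satisfy
  $\int_\Omega e_\nu = 0$ exactly when $e_\nu(r) + e_\nu(a+1-r) = 1 + e_\nu(a)$. Two unimodular
  numbers are determined up to order by a nonzero sum, so every difference $\nu$ of two points of a
  spectrum is either an integer with $\nu r$ or $\nu(a-r)$ an integer, or else satisfies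
  $\nu a \in \frac12 + \mathbb{Z}$ (\<open>spectrum_frequencies\<close>).

  If $\Lambda \subseteq \mathbb{Z}$, then combinations of the exponentials have period 1, so the
  second interval cannot meet an integer translate of the first one: otherwise
  $1_J - 1_{J+k}$, with $J$ and $J + k$ in $\Omega$, would be orthogonal to all of them. This forces $a - r \in \mathbb{Z}$. As
  $\mathbb{Z}$ itself is then a spectrum and spectra are maximal orthogonal families,
  $\Lambda = \mathbb{Z}$.

  If $\Lambda$ contains a non-integer $\theta$, the half-integer alternative applies to $\theta$ and
  to every difference $\lambda - \theta$ with $\lambda \in \Lambda$ an integer. Comparing these
  relations gives $\Lambda \subseteq G \cup (\theta + G)$ with
  $G = \{m \in \mathbb{Z} : ma, mr \in \mathbb{Z}\} = q\mathbb{Z}$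
  (\<open>spectrum_coset_structure\<close>). On an interval of length $1/q$ and its translates by
  multiples of $1/q$, the functions $e_\lambda$ with $\lambda \in \Lambda$ realise at most two
  different systems of translation factors, whereas $\Omega$ consists, up to a null set, of $q$ such
  translates. If $q \ge 3$, three of the translates carry a linear relation between the values of
  all $e_\lambda$, hence a nonzero function orthogonal to all of them
  (\<open>spectrum_no_shift_relation\<close>). So $q = 2$, which gives $r = \frac12$,
  $a \in \frac12\mathbb{Z}$ and, by maximality again, the second family.

  For the converse, completeness is reduced to uniform approximation: continuous functions vanishing
  off an open set are dense in its $L^2$ space (\<open>L2_approx_continuous\<close>), so it is enough
  to approximate such functions uniformly (\<open>is_spectrumI\<close>). When $a - r$ is an integer,
  $\Omega$ is a fundamental domain of $\mathbb{R}/\mathbb{Z}$ and a continuous function on it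
  becomes a continuous periodic one by moving the second interval next to the first. When
  $r = \frac12$ and $a = \frac n2$, the translation by $a$ multiplies the exponentials of one coset
  by 1 and those of the other by $-1$; the symmetric and antisymmetric parts of a function under
  this translation are approximated separately on $(0, \frac12)$.
\<close>

section \<open>Exponentials\<close>

definition wave :: "real \<Rightarrow> real \<Rightarrow> complex" where
  "wave \<nu> x = cis (2 * pi * (\<nu> * x))"

lemma exp_eq_wave:
  "exp (2 * complex_of_real pi * \<i> * complex_of_real \<nu> * complex_of_real x) = wave \<nu> x"
  by (simp add: wave_def cis_conv_exp mult_ac)

lemma wave_0 [simp]: "wave 0 x = 1" "wave \<nu> 0 = 1"
  by (simp_all add: wave_def)

lemma norm_wave [simp]: "cmod (wave \<nu> x) = 1"
  by (simp add: wave_def)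

lemma wave_nonzero [simp]: "wave \<nu> x \<noteq> 0"
  by (simp add: wave_def)

lemma wave_add: "wave \<nu> (x + y) = wave \<nu> x * wave \<nu> y"
  by (simp add: wave_def cis_mult algebra_simps)

lemma wave_add_freq: "wave (\<nu> + \<nu>') x = wave \<nu> x * wave \<nu>' x"
  by (simp add: wave_def cis_mult algebra_simps)

lemma wave_mult_cnj: "wave \<nu> x * cnj (wave \<nu>' x) = wave (\<nu> - \<nu>') x"
  by (simp add: wave_def cis_cnj cis_mult algebra_simps)

lemma wave_eq_1_iff: "wave \<nu> x = 1 \<longleftrightarrow> \<nu> * x \<in> \<int>"
proof -
  have "wave \<nu> x = 1 \<longleftrightarrow> (\<exists>n::int. 2 * pi * (\<nu> * x) = of_int (2 * n) * pi)"
    by (simp add: wave_def cis_conv_exp exp_eq_1)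
  also have "\<dots> \<longleftrightarrow> (\<exists>n::int. \<nu> * x = of_int n)"
    by (intro ex_cong1) (auto simp: field_simps)
  finally show ?thesis by (auto elim: Ints_cases)
qed

lemma wave_eq_minus_1_iff: "wave \<nu> x = -1 \<longleftrightarrow> \<nu> * x - 1 / 2 \<in> \<int>"
proof -
  have "wave \<nu> x = - wave 1 (\<nu> * x - 1 / 2)"
    by (simp add: wave_def algebra_simps flip: cis_divide)
  then show ?thesis
    using wave_eq_1_iff[of 1 "\<nu> * x - 1 / 2"] by simp
qed

lemma continuous_on_wave [continuous_intros]:
  "continuous_on S f \<Longrightarrow> continuous_on S (\<lambda>x. wave \<nu> (f x))"
  unfolding wave_def by (intro continuous_intros)

text \<open>
  Conjugation inverts numbers of modulus 1, so it turns the equation into one that determines the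
  product $uv = w$ unless the sums vanish. Then $u, v$ and $1, w$ are the roots of the same quadratic
  polynomial.
\<close>

lemma unit_sum_eq_cases:
  fixes u v w :: complex
  assumes "cmod u = 1" "cmod v = 1" "cmod w = 1" and eq: "u + v = 1 + w"
  shows "u = 1 \<and> v = w \<or> u = w \<and> v = 1 \<or> w = -1 \<and> v = - u"
proof -
  have inv: "cnj z = inverse z" if "cmod z = 1" for z
    using that complex_norm_square[of z] by (intro inverse_unique[symmetric]) (simp add: complex_norm_square)
  have "inverse u + inverse v = 1 + inverse w"
    using arg_cong[OF eq, of cnj] assms(1-3) by (simp add: inv[symmetric])
  moreover have nz: "u \<noteq> 0" "v \<noteq> 0" "w \<noteq> 0" using assms by auto
  ultimately have "(u + v) * w = (1 + w) * (u * v)"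
    by (simp add: field_simps)
  then have "(u + v) * (w - u * v) = 0"
    using eq by (simp add: algebra_simps)
  then consider "u + v = 0" | "w = u * v" by auto
  then show ?thesis
  proof cases
    case 1
    then have "1 + w = 0" using eq by simp
    with 1 show ?thesis by (simp add: add_eq_0_iff)
  next
    case 2
    then have "(u - 1) * (v - 1) = 0" using eq by (simp add: algebra_simps)
    then show ?thesis using eq by auto
  qed
qed

section \<open>Square-integrable functions\<close>

lemma L2_set_on_integrable_mult:
  assumes "f \<in> L2_set_on \<Omega>" "g \<in> L2_set_on \<Omega>"
  shows "integrable (lebesgue_on \<Omega>) (\<lambda>x. f x * cnj (g x))"
proof -
  have [measurable]: "f \<in> borel_measurable (lebesgue_on \<Omega>)" "g \<in> borel_measurable (lebesgue_on \<Omega>)"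
    using assms by (auto simp: L2_set_on_def)
  have [measurable]: "(\<lambda>x. cnj (g x)) \<in> borel_measurable (lebesgue_on \<Omega>)"
    by (intro measurable_compose[OF _ borel_measurable_continuous_onI[of cnj]] continuous_intros) simp
  have "integrable (lebesgue_on \<Omega>) (\<lambda>x. (cmod (f x))\<^sup>2 + (cmod (g x))\<^sup>2)"
    using assms by (auto simp: L2_set_on_def)
  then show ?thesis
  proof (rule Bochner_Integration.integrable_bound)
    have "norm (f x * cnj (g x)) \<le> norm ((cmod (f x))\<^sup>2 + (cmod (g x))\<^sup>2)" for x
    proof -
      have "0 \<le> cmod (f x) * cmod (g x)" by simp
      then have "cmod (f x) * cmod (g x) \<le> (cmod (f x))\<^sup>2 + (cmod (g x))\<^sup>2"
        using sum_squares_bound[of "cmod (f x)" "cmod (g x)"] by linarith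
      then show ?thesis by (simp add: norm_mult)
    qed
    then show "AE x in lebesgue_on \<Omega>. norm (f x * cnj (g x)) \<le> norm ((cmod (f x))\<^sup>2 + (cmod (g x))\<^sup>2)"
      by simp
  qed measurable
qed

lemma norm_sum_squared_le: "(norm (u + v))\<^sup>2 \<le> 2 * (norm u)\<^sup>2 + 2 * (norm v)\<^sup>2"
proof -
  have "(norm (u + v))\<^sup>2 \<le> (norm u + norm v)\<^sup>2"
    by (simp add: norm_triangle_ineq power_mono)
  also have "\<dots> \<le> 2 * (norm u)\<^sup>2 + 2 * (norm v)\<^sup>2"
    using sum_squares_bound[of "norm u" "norm v"] by (simp add: power2_sum)
  finally show ?thesis .
qed

lemma L2_set_on_add:
  assumes "f \<in> L2_set_on \<Omega>" "g \<in> L2_set_on \<Omega>"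
  shows "(\<lambda>x. f x + g x) \<in> L2_set_on \<Omega>"
proof -
  have [measurable]: "f \<in> borel_measurable (lebesgue_on \<Omega>)" "g \<in> borel_measurable (lebesgue_on \<Omega>)"
    using assms by (auto simp: L2_set_on_def)
  have "integrable (lebesgue_on \<Omega>) (\<lambda>x. 2 * (cmod (f x))\<^sup>2 + 2 * (cmod (g x))\<^sup>2)"
    using assms by (auto simp: L2_set_on_def)
  then have "integrable (lebesgue_on \<Omega>) (\<lambda>x. (cmod (f x + g x))\<^sup>2)"
    by (rule Bochner_Integration.integrable_bound) (auto simp: norm_sum_squared_le)
  then show ?thesis by (simp add: L2_set_on_def)
qed

lemma L2_set_on_cmult:
  assumes "f \<in> L2_set_on \<Omega>"
  shows "(\<lambda>x. c * f x) \<in> L2_set_on \<Omega>"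
  using assms by (auto simp: L2_set_on_def norm_mult power_mult_distrib)

lemma L2_set_on_diff:
  assumes "f \<in> L2_set_on \<Omega>" "g \<in> L2_set_on \<Omega>"
  shows "(\<lambda>x. f x - g x) \<in> L2_set_on \<Omega>"
  using L2_set_on_add[OF assms(1) L2_set_on_cmult[OF assms(2), of "-1"]] by simp

lemma L2_set_on_sum:
  assumes "\<And>k. k \<in> K \<Longrightarrow> f k \<in> L2_set_on \<Omega>"
  shows "(\<lambda>x. \<Sum>k\<in>K. f k x) \<in> L2_set_on \<Omega>"
  using assms
proof (induction K rule: infinite_finite_induct)
  case (insert k K)
  then show ?case using L2_set_on_add[of "f k" \<Omega>] by simp
qed (auto simp: L2_set_on_def)

lemma L2_set_on_bounded:
  assumes \<Omega>: "\<Omega> \<in> lmeasurable" and f: "f \<in> borel_measurable (lebesgue_on \<Omega>)"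
    and B: "\<And>x. x \<in> \<Omega> \<Longrightarrow> cmod (f x) \<le> B"
  shows "f \<in> L2_set_on \<Omega>"
proof -
  interpret finite_measure "lebesgue_on \<Omega>"
    using \<Omega> by (rule finite_measure_lebesgue_on)
  note [measurable] = f
  have "integrable (lebesgue_on \<Omega>) (\<lambda>x. (cmod (f x))\<^sup>2)"
    by (rule integrable_const_bound[where B = "B\<^sup>2"]) (auto intro!: AE_I2 power_mono B)
  then show ?thesis using f by (simp add: L2_set_on_def)
qed

text \<open>
  The factor 2 replaces the triangle inequality of the $L^2$ norm; it spares square roots of
  integrals and does no harm in approximation arguments.
\<close>

lemma L2_sqdist_triangle:
  assumes "f \<in> L2_set_on \<Omega>" "g \<in> L2_set_on \<Omega>" "h \<in> L2_set_on \<Omega>"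
  shows "L2_sqdist \<Omega> f h \<le> 2 * L2_sqdist \<Omega> f g + 2 * L2_sqdist \<Omega> g h"
proof -
  have i: "integrable (lebesgue_on \<Omega>) (\<lambda>x. (cmod (f x - h x))\<^sup>2)"
    "integrable (lebesgue_on \<Omega>) (\<lambda>x. (cmod (f x - g x))\<^sup>2)"
    "integrable (lebesgue_on \<Omega>) (\<lambda>x. (cmod (g x - h x))\<^sup>2)"
    using assms L2_set_on_diff by (auto simp: L2_set_on_def)
  have "L2_sqdist \<Omega> f h
      \<le> (LINT x|lebesgue_on \<Omega>. 2 * (cmod (f x - g x))\<^sup>2 + 2 * (cmod (g x - h x))\<^sup>2)"
    unfolding L2_sqdist_def
  proof (rule integral_mono)
    show "(cmod (f x - h x))\<^sup>2 \<le> 2 * (cmod (f x - g x))\<^sup>2 + 2 * (cmod (g x - h x))\<^sup>2" for x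
      using norm_sum_squared_le[of "f x - g x" "g x - h x"] by simp
  qed (use i in auto)
  also have "\<dots> = 2 * L2_sqdist \<Omega> f g + 2 * L2_sqdist \<Omega> g h"
    using i by (simp add: L2_sqdist_def)
  finally show ?thesis .
qed

lemma wave_L2:
  assumes "\<Omega> \<in> lmeasurable"
  shows "wave \<nu> \<in> L2_set_on \<Omega>"
proof (rule L2_set_on_bounded[OF assms, where B = 1])
  show "wave \<nu> \<in> borel_measurable (lebesgue_on \<Omega>)"
    using assms by (intro continuous_imp_measurable_on_sets_lebesgue continuous_intros) (auto simp: fmeasurableD)
qed auto

lemma integrable_wave:
  assumes "\<Omega> \<in> lmeasurable"
  shows "integrable (lebesgue_on \<Omega>) (wave \<nu>)"
  using L2_set_on_integrable_mult[OF wave_L2[OF assms, of \<nu>] wave_L2[OF assms, of 0]] by simp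

lemma measure_lebesgue_on_eq_1:
  assumes "\<Omega> \<in> sets borel" "emeasure lborel \<Omega> = 1"
  shows "\<Omega> \<in> lmeasurable" "measure (lebesgue_on \<Omega>) \<Omega> = 1"
proof -
  have em: "emeasure lebesgue \<Omega> = 1" using assms by simp
  then show lm: "\<Omega> \<in> lmeasurable" using assms by (intro fmeasurableI) auto
  show "measure (lebesgue_on \<Omega>) \<Omega> = 1"
    using em lm by (subst measure_restrict_space) (auto simp: measure_def fmeasurableD)
qed

section \<open>Density of continuous functions in $L^2$\<close>

lemma L2_sqdist_tendsto_0:
  assumes f: "f \<in> borel_measurable (lebesgue_on \<Omega>)"
    and h: "\<And>n. h n \<in> borel_measurable (lebesgue_on \<Omega>)"
    and w: "integrable (lebesgue_on \<Omega>) w"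
    and bound: "\<And>n x. x \<in> \<Omega> \<Longrightarrow> (cmod (f x - h n x))\<^sup>2 \<le> w x"
    and lim: "AE x in lebesgue_on \<Omega>. (\<lambda>n. h n x) \<longlonglongrightarrow> f x"
  shows "(\<lambda>n. L2_sqdist \<Omega> f (h n)) \<longlonglongrightarrow> 0"
proof -
  note [measurable] = f h
  have "(\<lambda>n. LINT x|lebesgue_on \<Omega>. (cmod (f x - h n x))\<^sup>2)
      \<longlonglongrightarrow> (LINT x|lebesgue_on \<Omega>. 0)"
  proof (rule integral_dominated_convergence[OF _ _ w])
    show "AE x in lebesgue_on \<Omega>. (\<lambda>n. (cmod (f x - h n x))\<^sup>2) \<longlonglongrightarrow> 0"
      using lim
    proof eventually_elim
      case (elim x)
      then have "(\<lambda>n. (cmod (f x - h n x))\<^sup>2) \<longlonglongrightarrow> (cmod (f x - f x))\<^sup>2"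
        by (intro tendsto_intros)
      then show ?case by simp
    qed
    show "AE x in lebesgue_on \<Omega>. norm ((cmod (f x - h n x))\<^sup>2) \<le> w x" for n
      using bound by (auto intro!: AE_I2)
  qed auto
  then show ?thesis by (simp add: L2_sqdist_def)
qed

text \<open>
  A measurable function is almost everywhere a limit of continuous functions $g_n$. Projecting the
  values to a closed disc that contains the range of $f$ makes the limit dominated, and the cutoffs
  $\min(1, n\,d(x, \Omega^c))$, which increase to 1 on the open set $\Omega$, make the
  approximants vanish off $\Omega$.
\<close>

lemma bounded_L2_approx_continuous:
  fixes f :: "real \<Rightarrow> complex"
  assumes \<Omega>: "open \<Omega>" "\<Omega> \<in> lmeasurable" and f: "f \<in> borel_measurable (lebesgue_on \<Omega>)"
    and B: "\<And>x. x \<in> \<Omega> \<Longrightarrow> cmod (f x) \<le> B" and "\<epsilon> > 0"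
  obtains h where "continuous_on UNIV h" "\<And>x. x \<notin> \<Omega> \<Longrightarrow> h x = 0" "h \<in> L2_set_on \<Omega>"
    "L2_sqdist \<Omega> f h < \<epsilon>"
proof -
  have B': "cmod (f x) \<le> \<bar>B\<bar>" if "x \<in> \<Omega>" for x using B[OF that] by linarith
  have "f measurable_on \<Omega>"
    using f \<Omega> by (subst measurable_on_iff_borel_measurable) (auto simp: fmeasurableD)
  then obtain N g where N: "negligible N" and g: "\<And>n. continuous_on UNIV (g n)"
    and lim: "\<And>x. x \<notin> N \<Longrightarrow> (\<lambda>n. g n x) \<longlonglongrightarrow> (if x \<in> \<Omega> then f x else 0)"
    unfolding measurable_on_def by metis
  define p where "p = closest_point (cball (0::complex) \<bar>B\<bar>)"
  define \<phi> where "\<phi> n x = min 1 (real n * infdist x (- \<Omega>))" for n :: nat and x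
  define h where "h n x = of_real (\<phi> n x) * p (g n x)" for n x
  have p: "continuous_on UNIV p"
    unfolding p_def by (rule continuous_on_closest_point) auto
  have p_le: "cmod (p z) \<le> \<bar>B\<bar>" for z
    using closest_point_in_set[of "cball (0::complex) \<bar>B\<bar>" z] by (simp add: p_def)
  have h_cont: "continuous_on UNIV (h n)" for n
    unfolding h_def \<phi>_def
    by (intro continuous_intros continuous_on_compose2[OF p g] continuous_on_min) auto
  have h_le: "cmod (h n x) \<le> \<bar>B\<bar>" for n x
  proof -
    have "0 \<le> \<phi> n x" "\<phi> n x \<le> 1" by (simp_all add: \<phi>_def infdist_nonneg)
    then have "\<bar>\<phi> n x\<bar> \<le> 1" by simp
    then have "\<bar>\<phi> n x\<bar> * cmod (p (g n x)) \<le> 1 * \<bar>B\<bar>"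
      by (intro mult_mono p_le) auto
    then show ?thesis by (simp add: h_def norm_mult)
  qed
  have h_meas: "h n \<in> borel_measurable (lebesgue_on \<Omega>)" for n
    using \<Omega> by (intro continuous_imp_measurable_on_sets_lebesgue continuous_on_subset[OF h_cont]) (auto simp: fmeasurableD)
  have "AE x in lebesgue. x \<notin> N"
    using N by (simp add: AE_not_in negligible_iff_null_sets)
  then have "AE x in lebesgue_on \<Omega>. x \<notin> N"
    using \<Omega> by (simp add: AE_restrict_space_iff fmeasurableD) (auto elim: eventually_mono)
  moreover have "AE x in lebesgue_on \<Omega>. x \<in> \<Omega>"
    using AE_space[of "lebesgue_on \<Omega>"] by simp
  ultimately have "AE x in lebesgue_on \<Omega>. (\<lambda>n. h n x) \<longlonglongrightarrow> f x"
  proof eventually_elim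
    case (elim x)
    have "(\<lambda>n. g n x) \<longlonglongrightarrow> f x" using lim[OF elim(1)] elim(2) by simp
    then have "(\<lambda>n. p (g n x)) \<longlonglongrightarrow> p (f x)"
      using p by (metis continuous_on_tendsto_compose UNIV_I eventually_sequentiallyI)
    moreover have "p (f x) = f x"
      unfolding p_def using B'[OF elim(2)] by (intro closest_point_self) simp
    moreover have "\<forall>\<^sub>F n in sequentially. \<phi> n x = 1"
    proof -
      have "\<Omega> \<noteq> UNIV" using \<Omega>(2) not_measurable_UNIV by auto
      then have "infdist x (- \<Omega>) > 0"
        using elim(2) \<Omega>(1) by (intro infdist_pos_not_in_closed) auto
      then have "filterlim (\<lambda>n. real n * infdist x (- \<Omega>)) at_top sequentially"
        by (intro filterlim_at_top_mult_tendsto_pos[OF tendsto_const] filterlim_real_sequentially)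
      then have "\<forall>\<^sub>F n in sequentially. 1 \<le> real n * infdist x (- \<Omega>)"
        by (simp add: filterlim_at_top)
      then show ?thesis by eventually_elim (simp add: \<phi>_def)
    qed
    ultimately have "(\<lambda>n. of_real (\<phi> n x) * p (g n x)) \<longlonglongrightarrow> of_real 1 * f x"
      by (intro tendsto_intros) (auto simp: tendsto_eventually)
    then show ?case by (simp add: h_def)
  qed
  moreover have "(cmod (f x - h n x))\<^sup>2 \<le> (2 * \<bar>B\<bar>)\<^sup>2" if "x \<in> \<Omega>" for n x
    using norm_triangle_ineq4[of "f x" "h n x"] B'[OF that] h_le[of n x] by (intro power_mono) auto
  moreover have "integrable (lebesgue_on \<Omega>) (\<lambda>x. (2 * \<bar>B\<bar>)\<^sup>2)"
    using finite_measure.integrable_const[OF finite_measure_lebesgue_on[OF \<Omega>(2)]] by blast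
  ultimately have "(\<lambda>n. L2_sqdist \<Omega> f (h n)) \<longlonglongrightarrow> 0"
    by (intro L2_sqdist_tendsto_0[OF f h_meas])
  then have "\<forall>\<^sub>F n in sequentially. L2_sqdist \<Omega> f (h n) < \<epsilon>"
    using \<open>\<epsilon> > 0\<close> by (rule order_tendstoD)
  then obtain n where "L2_sqdist \<Omega> f (h n) < \<epsilon>"
    using eventually_happens'[OF sequentially_bot] by blast
  moreover have "h n x = 0" if "x \<notin> \<Omega>" for x
    using that by (simp add: h_def \<phi>_def)
  moreover have "h n \<in> L2_set_on \<Omega>"
    using h_le by (rule L2_set_on_bounded[OF \<Omega>(2) h_meas])
  ultimately show thesis using that h_cont by blast
qed

text \<open>
  Truncation at a large height costs little in $L^2$ and reduces the claim to bounded functions.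
\<close>

lemma L2_approx_continuous:
  assumes \<Omega>: "open \<Omega>" "\<Omega> \<in> lmeasurable" and f: "f \<in> L2_set_on \<Omega>" and "\<epsilon> > 0"
  obtains h where "continuous_on UNIV h" "\<And>x. x \<notin> \<Omega> \<Longrightarrow> h x = 0" "h \<in> L2_set_on \<Omega>"
    "L2_sqdist \<Omega> f h < \<epsilon>"
proof -
  have f_meas [measurable]: "f \<in> borel_measurable (lebesgue_on \<Omega>)"
    using f by (simp add: L2_set_on_def)
  define t where "t n x = (if cmod (f x) \<le> real n then f x else 0)" for n x
  have t_meas: "t n \<in> borel_measurable (lebesgue_on \<Omega>)" for n
    unfolding t_def by measurable
  have "(\<lambda>n. L2_sqdist \<Omega> f (t n)) \<longlonglongrightarrow> 0"
  proof (rule L2_sqdist_tendsto_0[OF f_meas t_meas])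
    show "integrable (lebesgue_on \<Omega>) (\<lambda>x. (cmod (f x))\<^sup>2)"
      using f by (simp add: L2_set_on_def)
    show "(cmod (f x - t n x))\<^sup>2 \<le> (cmod (f x))\<^sup>2" for n x
      by (simp add: t_def)
    have "(\<lambda>n. t n x) \<longlonglongrightarrow> f x" for x
    proof (rule tendsto_eventually)
      obtain m :: nat where "cmod (f x) \<le> m" using real_arch_simple by blast
      then show "\<forall>\<^sub>F n in sequentially. t n x = f x"
        by (intro eventually_sequentiallyI[of m]) (auto simp: t_def)
    qed
    then show "AE x in lebesgue_on \<Omega>. (\<lambda>n. t n x) \<longlonglongrightarrow> f x" by simp
  qed
  then have "\<forall>\<^sub>F n in sequentially. L2_sqdist \<Omega> f (t n) < \<epsilon> / 4"
    using \<open>\<epsilon> > 0\<close> by (intro order_tendstoD) auto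
  then obtain n where n: "L2_sqdist \<Omega> f (t n) < \<epsilon> / 4"
    using eventually_happens'[OF sequentially_bot] by blast
  have t_le: "cmod (t n x) \<le> real n" for x by (simp add: t_def)
  obtain h where h: "continuous_on UNIV h" "\<And>x. x \<notin> \<Omega> \<Longrightarrow> h x = 0" "h \<in> L2_set_on \<Omega>"
    "L2_sqdist \<Omega> (t n) h < \<epsilon> / 4"
    using bounded_L2_approx_continuous[OF \<Omega> t_meas t_le, of "\<epsilon> / 4"] \<open>\<epsilon> > 0\<close> by (metis divide_pos_pos zero_less_numeral)
  have "L2_sqdist \<Omega> f h \<le> 2 * L2_sqdist \<Omega> f (t n) + 2 * L2_sqdist \<Omega> (t n) h"
    using t_le by (intro L2_sqdist_triangle f h L2_set_on_bounded[OF \<Omega>(2) t_meas])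
  also have "\<dots> < \<epsilon>" using n h(4) by simp
  finally show thesis using that h by blast
qed

section \<open>Uniform approximation by trigonometric polynomials\<close>

text \<open>
  Closing the monomials under sums makes stability under products a plain double induction;
  \<open>trig_poly_expand\<close> recovers the usual form with distinct frequencies.
\<close>

inductive trig_poly :: "real \<Rightarrow> (real \<Rightarrow> complex) \<Rightarrow> bool" for \<theta> where
  monomial: "trig_poly \<theta> (\<lambda>x. c * wave (of_int k * \<theta>) x)"
| add: "trig_poly \<theta> f \<Longrightarrow> trig_poly \<theta> g \<Longrightarrow> trig_poly \<theta> (\<lambda>x. f x + g x)"

lemma trig_poly_mult:
  assumes "trig_poly \<theta> f" "trig_poly \<theta> g"
  shows "trig_poly \<theta> (\<lambda>x. f x * g x)"
  using assms(1)
proof induction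
  case (monomial c k)
  from assms(2) show ?case
  proof induction
    case (monomial d l)
    have "(\<lambda>x. c * wave (of_int k * \<theta>) x * (d * wave (of_int l * \<theta>) x))
        = (\<lambda>x. c * d * wave (of_int (k + l) * \<theta>) x)"
      by (simp add: algebra_simps wave_add_freq)
    then show ?case by (simp only: trig_poly.monomial)
  next
    case (add f g)
    then show ?case using trig_poly.add by (simp add: distrib_left)
  qed
next
  case (add f g)
  then show ?case using trig_poly.add by (simp add: distrib_right)
qed

lemma trig_poly_expand:
  assumes "trig_poly \<theta> f"
  shows "\<exists>K c. finite K \<and> (\<forall>x. f x = (\<Sum>k\<in>K. c k * wave (of_int k * \<theta>) x))"
  using assms
proof induction
  case (monomial c k)
  show ?case by (rule exI[of _ "{k}"], rule exI[of _ "\<lambda>_. c"]) simp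
next
  case (add f g)
  then obtain K c L d where K: "finite K" "\<forall>x. f x = (\<Sum>k\<in>K. c k * wave (of_int k * \<theta>) x)"
    and L: "finite L" "\<forall>x. g x = (\<Sum>k\<in>L. d k * wave (of_int k * \<theta>) x)"
    by blast
  define b where "b k = (if k \<in> K then c k else 0) + (if k \<in> L then d k else 0)" for k
  have "f x + g x = (\<Sum>k\<in>K \<union> L. b k * wave (of_int k * \<theta>) x)" for x
  proof -
    have "f x = (\<Sum>k\<in>K \<union> L. (if k \<in> K then c k else 0) * wave (of_int k * \<theta>) x)"
      using K L by (auto intro!: sum.mono_neutral_cong_left)
    moreover have "g x = (\<Sum>k\<in>K \<union> L. (if k \<in> L then d k else 0) * wave (of_int k * \<theta>) x)"
      using K L by (auto intro!: sum.mono_neutral_cong_left)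
    ultimately show ?thesis by (simp add: b_def distrib_right sum.distrib)
  qed
  then show ?case using K L by blast
qed

text \<open>
  On the unit circle a real-linear form is a combination of $z$ and $\bar z = z^{-1}$.
\<close>

lemma polynomial_on_circle_trig_poly:
  fixes p :: "complex \<Rightarrow> real"
  assumes "real_polynomial_function p"
  shows "trig_poly \<theta> (\<lambda>x. of_real (p (wave \<theta> x)))"
  using assms
proof induction
  case (linear f)
  have "of_real (f (wave \<theta> x))
      = (of_real (f 1) - \<i> * of_real (f \<i>)) / 2 * wave (of_int 1 * \<theta>) x
      + (of_real (f 1) + \<i> * of_real (f \<i>)) / 2 * wave (of_int (-1) * \<theta>) x" for x
  proof -
    have "wave \<theta> x = Re (wave \<theta> x) *\<^sub>R 1 + Im (wave \<theta> x) *\<^sub>R \<i>"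
      by (simp add: complex_eq_iff)
    then have "f (wave \<theta> x) = f (Re (wave \<theta> x) *\<^sub>R 1 + Im (wave \<theta> x) *\<^sub>R \<i>)"
      by simp
    also have "\<dots> = Re (wave \<theta> x) * f 1 + Im (wave \<theta> x) * f \<i>"
      using linear by (simp only: linear_add linear_scale bounded_linear.linear) simp
    finally show ?thesis
      by (simp add: complex_eq_iff wave_def field_simps)
  qed
  then show ?case by (simp only: trig_poly.intros)
next
  case (const c)
  show ?case using trig_poly.monomial[of \<theta> "of_real c" 0] by simp
next
  case (add f g)
  then show ?case using trig_poly.add by simp
next
  case (mult f g)
  then show ?case using trig_poly_mult by simp
qed

text \<open>
  A function with equal values at both ends of the interval is a loop, hence a continuous function on
  the unit circle, where the Stone--Weierstrass theorem provides polynomials in the real and the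
  imaginary part. Restricted to the circle, these are trigonometric polynomials.
\<close>

lemma uniform_trig_approx:
  fixes h :: "real \<Rightarrow> complex"
  assumes "L > 0" and h: "continuous_on {0..L} h" and ends: "h 0 = h L" and "\<epsilon> > 0"
  obtains K c where "finite K"
    "\<And>x. x \<in> {0..L} \<Longrightarrow> cmod (h x - (\<Sum>k\<in>K. c k * wave (of_int k / L) x)) < \<epsilon>"
proof -
  define p where "p t = h (L * t)" for t
  have "path p"
    unfolding path_def p_def using \<open>L > 0\<close>
    by (intro continuous_on_compose2[OF h] continuous_intros) (auto simp: mult_left_le)
  then have "homotopic_loops UNIV p p"
    using ends by (simp add: homotopic_loops_refl pathstart_def pathfinish_def p_def)
  then have "homotopic_with_canon (\<lambda>h. True) (sphere 0 1) UNIV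
      (p \<circ> (\<lambda>z. Arg2pi z / (2 * pi))) (p \<circ> (\<lambda>z. Arg2pi z / (2 * pi)))"
    by (rule homotopic_loops_imp_homotopic_circlemaps)
  then have "continuous_on (sphere 0 1) (p \<circ> (\<lambda>z. Arg2pi z / (2 * pi)))"
    by (simp add: homotopic_with_imp_continuous)
  then obtain g where g: "polynomial_function g"
    and near: "\<forall>z\<in>sphere 0 1. cmod ((p \<circ> (\<lambda>z. Arg2pi z / (2 * pi))) z - g z) < \<epsilon>"
    using Stone_Weierstrass_polynomial_function[OF compact_sphere _ \<open>\<epsilon> > 0\<close>] by blast
  have "real_polynomial_function (Re \<circ> g)" "real_polynomial_function (Im \<circ> g)"
    using g by (auto simp: polynomial_function_def bounded_linear_Re bounded_linear_Im)
  then have "trig_poly (1 / L) (\<lambda>x. of_real ((Re \<circ> g) (wave (1 / L) x)) +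
      (\<i> * wave (of_int 0 * (1 / L)) x) * of_real ((Im \<circ> g) (wave (1 / L) x)))"
    by (intro trig_poly.add trig_poly_mult trig_poly.monomial polynomial_on_circle_trig_poly)
  then have "trig_poly (1 / L) (\<lambda>x. g (wave (1 / L) x))"
    by (simp flip: complex_eq)
  from trig_poly_expand[OF this] obtain K c where K: "finite K"
    and exp: "\<And>x. g (wave (1 / L) x) = (\<Sum>k\<in>K. c k * wave (of_int k / L) x)"
    by auto
  have "cmod (h x - g (wave (1 / L) x)) < \<epsilon>" if x: "x \<in> {0..L}" for x
  proof -
    have less: "cmod (h y - g (wave (1 / L) y)) < \<epsilon>" if y: "0 \<le> y" "y < L" for y
    proof -
      have "wave (1 / L) y = exp (\<i> * of_real (2 * pi * (y / L)))"
        by (simp add: wave_def cis_conv_exp mult_ac)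
      moreover have "Arg2pi (exp (\<i> * of_real (2 * pi * (y / L)))) = 2 * pi * (y / L)"
        using y \<open>L > 0\<close> by (subst Arg2pi_exp) (auto simp: divide_less_eq)
      ultimately have "(p \<circ> (\<lambda>z. Arg2pi z / (2 * pi))) (wave (1 / L) y) = h y"
        using \<open>L > 0\<close> by (simp add: p_def)
      then show ?thesis
        using near[rule_format, of "wave (1 / L) y"] by simp
    qed
    show ?thesis
    proof (cases "x = L")
      case True
      have "wave (1 / L) L = 1" using \<open>L > 0\<close> by (simp add: wave_eq_1_iff)
      then show ?thesis using less[of 0] \<open>L > 0\<close> True ends by simp
    qed (use x less in auto)
  qed
  then show thesis using that[OF K, of c] by (simp add: exp)
qed

section \<open>Spectra of sets of measure one\<close>

text \<open>
  Since $|\Omega| = 1$, a uniform error $\delta$ on $\Omega$ bounds the squared $L^2$ distance by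
  $\delta^2$, and density of the continuous functions reduces completeness to their uniform
  approximation.
\<close>

lemma is_spectrumI:
  fixes \<mu> :: "int \<Rightarrow> real"
  assumes "open \<Omega>" and \<Omega>1: "emeasure lborel \<Omega> = 1" and "inj \<mu>"
    and orth: "\<And>j k. j \<noteq> k \<Longrightarrow> (LINT x|lebesgue_on \<Omega>. wave (\<mu> j - \<mu> k) x) = 0"
    and approx: "\<And>h \<epsilon>. \<lbrakk>continuous_on UNIV h; \<And>x. x \<notin> \<Omega> \<Longrightarrow> h x = 0; \<epsilon> > 0\<rbrakk> \<Longrightarrow>
      \<exists>K c. finite K \<and> (\<forall>x\<in>\<Omega>. cmod (h x - (\<Sum>k\<in>K. c k * wave (\<mu> k) x)) \<le> \<epsilon>)"
  shows "is_spectrum \<Omega> (range \<mu>)"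
proof -
  have borel: "\<Omega> \<in> sets borel" using \<open>open \<Omega>\<close> by simp
  note lm = measure_lebesgue_on_eq_1(1)[OF borel \<Omega>1] and m1 = measure_lebesgue_on_eq_1(2)[OF borel \<Omega>1]
  have "\<exists>K c. finite K \<and> L2_sqdist \<Omega> f (\<lambda>x. \<Sum>k\<in>K. c k * wave (\<mu> k) x) < \<epsilon>"
    if f: "f \<in> L2_set_on \<Omega>" and \<epsilon>: "\<epsilon> > 0" for f \<epsilon>
  proof -
    obtain h where h: "continuous_on UNIV h" "\<And>x. x \<notin> \<Omega> \<Longrightarrow> h x = 0" "h \<in> L2_set_on \<Omega>"
      "L2_sqdist \<Omega> f h < \<epsilon> / 4"
      using L2_approx_continuous[OF \<open>open \<Omega>\<close> lm f, of "\<epsilon> / 4"] \<epsilon> by auto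
    define \<delta> where "\<delta> = sqrt (\<epsilon> / 8)"
    have \<delta>: "\<delta> > 0" "\<delta>\<^sup>2 = \<epsilon> / 8" using \<epsilon> by (auto simp: \<delta>_def)
    obtain K c where K: "finite K"
      and near: "\<forall>x\<in>\<Omega>. cmod (h x - (\<Sum>k\<in>K. c k * wave (\<mu> k) x)) \<le> \<delta>"
      using approx[OF h(1,2) \<delta>(1)] by blast
    define S where "S = (\<lambda>x. \<Sum>k\<in>K. c k * wave (\<mu> k) x)"
    have S: "S \<in> L2_set_on \<Omega>"
      unfolding S_def by (intro L2_set_on_sum L2_set_on_cmult wave_L2[OF lm])
    have "L2_sqdist \<Omega> h S \<le> (LINT x|lebesgue_on \<Omega>. \<delta>\<^sup>2)"
      unfolding L2_sqdist_def
    proof (rule integral_mono)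
      show "integrable (lebesgue_on \<Omega>) (\<lambda>x. (cmod (h x - S x))\<^sup>2)"
        using L2_set_on_diff[OF h(3) S] by (simp add: L2_set_on_def)
      show "integrable (lebesgue_on \<Omega>) (\<lambda>x. \<delta>\<^sup>2)"
        using finite_measure.integrable_const[OF finite_measure_lebesgue_on[OF lm]] by blast
    qed (use near in \<open>auto simp: S_def intro!: power_mono\<close>)
    also have "\<dots> = \<epsilon> / 8" using m1 \<delta> by simp
    finally have "L2_sqdist \<Omega> f S < \<epsilon>"
      using L2_sqdist_triangle[OF f h(3) S] h(4) \<epsilon> by linarith
    then show ?thesis using K unfolding S_def by blast
  qed
  moreover have "L2_inner \<Omega> (wave (\<mu> j)) (wave (\<mu> k)) = (if j = k then 1 else 0)" for j k
    using orth[of j k] m1 by (simp add: L2_inner_def wave_mult_cnj)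
  ultimately have "L2_orthonormal_basis \<Omega> (\<lambda>k. wave (\<mu> k))"
    unfolding L2_orthonormal_basis_def using wave_L2[OF lm] by blast
  then show ?thesis
    unfolding is_spectrum_def exp_eq_wave using borel \<Omega>1 \<open>inj \<mu>\<close> by blast
qed

text \<open>
  By Pythagoras, a function orthogonal to the basis is at least as far from every finite combination
  as from 0, yet the distances become arbitrarily small.
\<close>

lemma orthonormal_basis_orthogonal_imp_zero:
  assumes e: "L2_orthonormal_basis \<Omega> e" and g: "g \<in> L2_set_on \<Omega>"
    and orth: "\<And>k. L2_inner \<Omega> (e k) g = 0"
  shows "(LINT x|lebesgue_on \<Omega>. (cmod (g x))\<^sup>2) = 0"
proof -
  let ?I = "LINT x|lebesgue_on \<Omega>. (cmod (g x))\<^sup>2"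
  have ek: "e k \<in> L2_set_on \<Omega>" for k using e by (simp add: L2_orthonormal_basis_def)
  have "?I < \<epsilon>" if pos: "\<epsilon> > 0" for \<epsilon>
  proof -
    obtain K c where K: "finite K" and less: "L2_sqdist \<Omega> g (\<lambda>x. \<Sum>k\<in>K. c k * e k x) < \<epsilon>"
      using e[unfolded L2_orthonormal_basis_def, THEN conjunct2, THEN conjunct2, rule_format, OF g pos]
      by blast
    define S where "S = (\<lambda>x. \<Sum>k\<in>K. c k * e k x)"
    have S: "S \<in> L2_set_on \<Omega>"
      unfolding S_def by (intro L2_set_on_sum L2_set_on_cmult ek)
    have int: "integrable (lebesgue_on \<Omega>) (\<lambda>x. S x * cnj (g x))"
      by (rule L2_set_on_integrable_mult[OF S g])
    have "(LINT x|lebesgue_on \<Omega>. S x * cnj (g x))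
        = (LINT x|lebesgue_on \<Omega>. (\<Sum>k\<in>K. c k * (e k x * cnj (g x))))"
      by (simp add: S_def sum_distrib_right mult.assoc)
    also have "\<dots> = (\<Sum>k\<in>K. c k * L2_inner \<Omega> (e k) g)"
      using L2_set_on_integrable_mult[OF ek g]
      by (subst Bochner_Integration.integral_sum) (auto simp: L2_inner_def)
    finally have zero: "(LINT x|lebesgue_on \<Omega>. S x * cnj (g x)) = 0"
      by (simp add: orth)
    have "(LINT x|lebesgue_on \<Omega>. Re (S x * cnj (g x))) = 0"
      using int zero by (simp del: times_complex.sel)
    moreover have "(cmod (g x - S x))\<^sup>2
        = (cmod (g x))\<^sup>2 + (cmod (S x))\<^sup>2 - 2 * Re (S x * cnj (g x))" for x
      by (simp only: cmod_power2) (simp add: power2_eq_square algebra_simps)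
    moreover have "integrable (lebesgue_on \<Omega>) (\<lambda>x. Re (S x * cnj (g x)))"
      using int by (rule integrable_Re)
    ultimately have "L2_sqdist \<Omega> g S = ?I + (LINT x|lebesgue_on \<Omega>. (cmod (S x))\<^sup>2)"
      using g S by (simp add: L2_sqdist_def L2_set_on_def del: times_complex.sel)
    moreover have "0 \<le> (LINT x|lebesgue_on \<Omega>. (cmod (S x))\<^sup>2)" by simp
    ultimately show ?thesis using less unfolding S_def by linarith
  qed
  moreover have "0 \<le> ?I" by simp
  ultimately show ?thesis by (metis less_irrefl less_eq_real_def)
qed

lemma is_spectrumE:
  assumes "is_spectrum \<Omega> \<Lambda>"
  obtains \<mu> :: "int \<Rightarrow> real" where "inj \<mu>" "\<Lambda> = range \<mu>" "\<Omega> \<in> lmeasurable"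
    "measure (lebesgue_on \<Omega>) \<Omega> = 1" "L2_orthonormal_basis \<Omega> (\<lambda>k. wave (\<mu> k))"
  using assms measure_lebesgue_on_eq_1 unfolding is_spectrum_def exp_eq_wave by metis

lemma spectrum_orthogonal:
  assumes "is_spectrum \<Omega> \<Lambda>" "\<alpha> \<in> \<Lambda>" "\<beta> \<in> \<Lambda>" "\<alpha> \<noteq> \<beta>"
  shows "L2_inner \<Omega> (wave \<alpha>) (wave \<beta>) = 0"
  using assms(1)
proof (rule is_spectrumE)
  fix \<mu> :: "int \<Rightarrow> real"
  assume "\<Lambda> = range \<mu>" and b: "L2_orthonormal_basis \<Omega> (\<lambda>k. wave (\<mu> k))"
  then obtain j k where "\<alpha> = \<mu> j" "\<beta> = \<mu> k" "j \<noteq> k" using assms by auto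
  then show ?thesis using b by (simp add: L2_orthonormal_basis_def)
qed

lemma spectrum_complete:
  assumes "is_spectrum \<Omega> \<Lambda>" "g \<in> L2_set_on \<Omega>"
    and "\<And>\<alpha>. \<alpha> \<in> \<Lambda> \<Longrightarrow> L2_inner \<Omega> (wave \<alpha>) g = 0"
  shows "(LINT x|lebesgue_on \<Omega>. (cmod (g x))\<^sup>2) = 0"
  using assms(1)
proof (rule is_spectrumE)
  fix \<mu> :: "int \<Rightarrow> real"
  assume "\<Lambda> = range \<mu>" and b: "L2_orthonormal_basis \<Omega> (\<lambda>k. wave (\<mu> k))"
  then show ?thesis using orthonormal_basis_orthogonal_imp_zero[OF b assms(2)] assms(3) by blast
qed

text \<open>
  Spectra are maximal: an exponential of the larger spectrum that is missing from the smaller one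
  would be orthogonal to a complete family.
\<close>

lemma spectrum_subset_imp_eq:
  assumes sp: "is_spectrum \<Omega> \<Lambda>" and sp': "is_spectrum \<Omega> \<Lambda>'" and sub: "\<Lambda> \<subseteq> \<Lambda>'"
  shows "\<Lambda> = \<Lambda>'"
proof (rule ccontr)
  assume "\<Lambda> \<noteq> \<Lambda>'"
  then obtain \<nu> where \<nu>: "\<nu> \<in> \<Lambda>'" "\<nu> \<notin> \<Lambda>" using sub by blast
  obtain \<mu> :: "int \<Rightarrow> real" where lm: "\<Omega> \<in> lmeasurable" and m1: "measure (lebesgue_on \<Omega>) \<Omega> = 1"
    using sp by (rule is_spectrumE)
  have "(LINT x|lebesgue_on \<Omega>. (cmod (wave \<nu> x))\<^sup>2) = 0"
  proof (rule spectrum_complete[OF sp wave_L2[OF lm]])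
    show "L2_inner \<Omega> (wave \<alpha>) (wave \<nu>) = 0" if "\<alpha> \<in> \<Lambda>" for \<alpha>
      using that \<nu> sub by (intro spectrum_orthogonal[OF sp']) auto
  qed
  then show False using m1 by simp
qed

lemma LINT_wave_interval:
  assumes "\<Omega> \<in> sets lebesgue" "{p<..<q} \<subseteq> \<Omega>"
  shows "(LINT x|lebesgue_on \<Omega>. (if x \<in> {p<..<q} then wave \<nu> x else 0)) = integral {p..q} (wave \<nu>)"
proof -
  have "(LINT x|lebesgue_on \<Omega>. (if x \<in> {p<..<q} then wave \<nu> x else 0))
      = integral\<^sup>L (lebesgue_on ({p<..<q} \<inter> \<Omega>)) (wave \<nu>)"
    using assms(1) by (intro Lebesgue_Measure.integral_restrict_Int) auto
  also have "{p<..<q} \<inter> \<Omega> = {p<..<q}" using assms(2) by blast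
  also have "integral\<^sup>L (lebesgue_on {p<..<q}) (wave \<nu>) = integral {p<..<q} (wave \<nu>)"
    by (intro lebesgue_integral_eq_integral integrable_wave) auto
  also have "\<dots> = integral {p..q} (wave \<nu>)"
    by (simp add: integral_open_interval_real)
  finally show ?thesis .
qed

lemma integral_wave_shift:
  "integral {u + d..v + d} (wave \<nu>) = wave \<nu> d * integral {u..v} (wave \<nu>)"
proof -
  have "integral {u + d..v + d} (wave \<nu>) = integral {u..v} (\<lambda>x. wave \<nu> d * wave \<nu> x)"
    by (simp add: o_def wave_add flip: integral_shift_Icc_real)
  then show ?thesis by simp
qed

text \<open>
  Passing from $J = (u, v)$ to $J + d$ multiplies $\int_J e_\alpha$ by $e_\alpha(d)$. A linear
  relation among these factors, valid for all $\alpha \in \Lambda$, therefore makes the step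
  function $\sum_d \overline{c_d}\,1_{J+d}$ orthogonal to all exponentials, so that it vanishes.
  Both obstructions in the classification are instances, with two and with three translates.
\<close>

lemma spectrum_no_shift_relation:
  fixes c :: "real \<Rightarrow> complex"
  assumes sp: "is_spectrum \<Omega> \<Lambda>" and "u < v" and D: "finite D"
    and sub: "\<And>d. d \<in> D \<Longrightarrow> {u + d<..<v + d} \<subseteq> \<Omega>"
    and disj: "\<And>d d'. \<lbrakk>d \<in> D; d' \<in> D; d \<noteq> d'\<rbrakk> \<Longrightarrow> {u + d<..<v + d} \<inter> {u + d'<..<v + d'} = {}"
    and rel: "\<And>\<alpha>. \<alpha> \<in> \<Lambda> \<Longrightarrow> (\<Sum>d\<in>D. c d * wave \<alpha> d) = 0"
    and "d \<in> D"
  shows "c d = 0"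
proof -
  define J where "J d = {u + d<..<v + d}" for d
  define g where "g x = (\<Sum>d\<in>D. cnj (c d) * (if x \<in> J d then wave 0 x else 0))" for x
  obtain \<mu> :: "int \<Rightarrow> real" where lm: "\<Omega> \<in> lmeasurable"
    using sp by (rule is_spectrumE)
  have \<Omega>: "\<Omega> \<in> sets lebesgue" using lm by auto
  have meas: "(\<lambda>x. if x \<in> J d then wave \<alpha> x else 0) \<in> borel_measurable (lebesgue_on \<Omega>)" if "d \<in> D" for d \<alpha>
    using that \<Omega> sub unfolding J_def
    by (subst borel_measurable_if_lebesgue_on)
       (auto intro!: continuous_imp_measurable_on_sets_lebesgue continuous_intros)
  have piece: "(\<lambda>x. if x \<in> J d then wave \<alpha> x else 0) \<in> L2_set_on \<Omega>" if "d \<in> D" for d \<alpha>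
    using that by (intro L2_set_on_bounded[OF lm meas, where B = 1]) auto
  have g: "g \<in> L2_set_on \<Omega>"
    unfolding g_def by (intro L2_set_on_sum L2_set_on_cmult piece)
  have "L2_inner \<Omega> (wave \<alpha>) g = 0" if "\<alpha> \<in> \<Lambda>" for \<alpha>
  proof -
    have int: "integrable (lebesgue_on \<Omega>) (\<lambda>x. if x \<in> J d then wave \<alpha> x else 0)" if "d \<in> D" for d
      using L2_set_on_integrable_mult[OF piece[OF that, of \<alpha>] wave_L2[OF lm, of 0]] by simp
    have "L2_inner \<Omega> (wave \<alpha>) g
        = (LINT x|lebesgue_on \<Omega>. (\<Sum>d\<in>D. c d * (if x \<in> J d then wave \<alpha> x else 0)))"
      unfolding L2_inner_def g_def
      by (intro Bochner_Integration.integral_cong refl)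
         (auto simp: sum_distrib_left intro!: sum.cong)
    also have "\<dots> = (\<Sum>d\<in>D. c d * (LINT x|lebesgue_on \<Omega>. (if x \<in> J d then wave \<alpha> x else 0)))"
      using int by (subst Bochner_Integration.integral_sum) auto
    also have "\<dots> = (\<Sum>d\<in>D. c d * (wave \<alpha> d * integral {u..v} (wave \<alpha>)))"
      using sub unfolding J_def
      by (intro sum.cong refl) (simp only: LINT_wave_interval[OF \<Omega>] integral_wave_shift)
    also have "\<dots> = (\<Sum>d\<in>D. c d * wave \<alpha> d) * integral {u..v} (wave \<alpha>)"
      by (simp add: sum_distrib_right mult.assoc)
    finally show ?thesis using rel[OF that] by simp
  qed
  then have zero: "(LINT x|lebesgue_on \<Omega>. (cmod (g x))\<^sup>2) = 0"
    by (rule spectrum_complete[OF sp g])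
  have on_J: "g x = cnj (c d)" if "x \<in> J d" for x
  proof -
    have "x \<notin> J d'" if "d' \<in> D" "d' \<noteq> d" for d'
      using disj[OF that(1) \<open>d \<in> D\<close> that(2)] \<open>x \<in> J d\<close> unfolding J_def by blast
    then have "g x = (\<Sum>d'\<in>D. if d' = d then cnj (c d) else 0)"
      unfolding g_def using that by (intro sum.cong) auto
    then show ?thesis using D \<open>d \<in> D\<close> by simp
  qed
  have "(LINT x|lebesgue_on \<Omega>. (cmod (c d))\<^sup>2 * indicator (J d) x) \<le> 0"
    unfolding zero[symmetric]
  proof (rule integral_mono)
    show "integrable (lebesgue_on \<Omega>) (\<lambda>x. (cmod (c d))\<^sup>2 * indicator (J d) x)"
      using sub[OF \<open>d \<in> D\<close>] \<Omega> \<open>u < v\<close>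
      by (intro integrable_mult_right integrable_real_indicator)
         (auto simp: J_def emeasure_restrict_space sets_restrict_space_iff)
    show "integrable (lebesgue_on \<Omega>) (\<lambda>x. (cmod (g x))\<^sup>2)"
      using g by (simp add: L2_set_on_def)
  qed (auto simp: indicator_def on_J)
  moreover have "measure (lebesgue_on \<Omega>) (J d \<inter> \<Omega>) = v - u"
    using sub[OF \<open>d \<in> D\<close>] \<Omega> \<open>u < v\<close> by (subst measure_restrict_space) (auto simp: J_def Int_absorb2)
  ultimately have "(cmod (c d))\<^sup>2 * (v - u) \<le> 0"
    by simp
  then show "c d = 0"
    using \<open>u < v\<close> by (simp add: mult_le_0_iff)
qed

section \<open>Subgroups of the integers\<close>

text \<open>
  The generator is the least positive element; remainders modulo it stay in the subgroup.
\<close>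

lemma subgroup_of_int_generator:
  fixes G :: "int set"
  assumes diff: "\<And>x y. \<lbrakk>x \<in> G; y \<in> G\<rbrakk> \<Longrightarrow> x - y \<in> G" and "z \<in> G" "z \<noteq> 0"
  obtains q where "q > 0" "q \<in> G" "\<And>x. x \<in> G \<Longrightarrow> q dvd x"
proof -
  have "0 \<in> G" using diff[OF \<open>z \<in> G\<close> \<open>z \<in> G\<close>] by simp
  then have neg: "- x \<in> G" if "x \<in> G" for x using diff[OF _ that, of 0] by simp
  then have add: "x + y \<in> G" if "x \<in> G" "y \<in> G" for x y using diff[of x "- y"] that by simp
  have nat_mult: "int k * x \<in> G" if "x \<in> G" for k x
    using that \<open>0 \<in> G\<close> add by (induction k) (auto simp: distrib_right)
  have mult: "k * x \<in> G" if "x \<in> G" for k x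
    using nat_mult[OF that, of "nat \<bar>k\<bar>"] neg by (cases "k \<ge> 0") fastforce+
  define m where "m = (LEAST m. m > 0 \<and> int m \<in> G)"
  have "nat \<bar>z\<bar> > 0 \<and> int (nat \<bar>z\<bar>) \<in> G"
    using \<open>z \<in> G\<close> \<open>z \<noteq> 0\<close> neg[OF \<open>z \<in> G\<close>] by (simp add: abs_if)
  then have m: "m > 0 \<and> int m \<in> G"
    unfolding m_def by (rule LeastI)
  have "int m dvd x" if "x \<in> G" for x
  proof (rule ccontr)
    assume "\<not> int m dvd x"
    then have "x mod int m \<noteq> 0" by (simp add: dvd_eq_mod_eq_0)
    moreover have "x mod int m \<ge> 0" "x mod int m < int m" using m by simp_all
    moreover have "x mod int m \<in> G"
      using diff[OF that mult[of "int m" "x div int m"]] m by (simp add: minus_div_mult_eq_mod)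
    ultimately have "nat (x mod int m) > 0 \<and> int (nat (x mod int m)) \<in> G" "nat (x mod int m) < m"
      by auto
    then show False unfolding m_def using not_less_Least by blast
  qed
  then show thesis using that[of "int m"] m by simp
qed

section \<open>Spectra of two intervals\<close>

lemma has_integral_wave_interval:
  assumes "\<nu> \<noteq> 0" "p \<le> q"
  shows "(wave \<nu> has_integral (wave \<nu> q - wave \<nu> p) / (2 * of_real pi * \<i> * of_real \<nu>)) {p<..<q}"
proof -
  have "(wave \<nu> has_integral (wave \<nu> q / (2 * of_real pi * \<i> * of_real \<nu>) - wave \<nu> p / (2 * of_real pi * \<i> * of_real \<nu>))) {p..q}"
  proof (rule fundamental_theorem_of_calculus[OF \<open>p \<le> q\<close>])
    fix x assume "x \<in> {p..q}"
    have "((\<lambda>z. exp (2 * of_real pi * \<i> * of_real \<nu> * z) / (2 * of_real pi * \<i> * of_real \<nu>)) has_field_derivative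
        exp (2 * of_real pi * \<i> * of_real \<nu> * of_real x)) (at (of_real x))"
      using \<open>\<nu> \<noteq> 0\<close> by (auto intro!: derivative_eq_intros)
    from has_vector_derivative_real_field[OF this]
    show "((\<lambda>x. wave \<nu> x / (2 * of_real pi * \<i> * of_real \<nu>)) has_vector_derivative wave \<nu> x) (at x within {p..q})"
      by (simp add: exp_eq_wave has_vector_derivative_at_within o_def)
  qed
  then show ?thesis
    by (simp add: diff_divide_distrib has_integral_Icc_iff_Ioo)
qed

text \<open>
  For odd $p$ and $r = \frac12$, $a = \frac n2$, these are the spectra that need not be
  $\mathbb{Z}$.
\<close>

definition alternating_frequencies :: "int \<Rightarrow> int \<Rightarrow> real set" where
  "alternating_frequencies p n = range (\<lambda>m::int. 2 * of_int m)
     \<union> range (\<lambda>m::int. of_int p / of_int n + 2 * of_int m)"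

locale two_intervals =
  fixes r a :: real
  assumes r_pos: "0 < r" and r_le_half: "r \<le> 1 / 2" and r_le_a: "r \<le> a"
begin

definition \<Omega> :: "real set" where
  "\<Omega> = {0<..<r} \<union> {a<..<a + 1 - r}"

lemma open_\<Omega>: "open \<Omega>"
  by (simp add: \<Omega>_def open_Un)

lemma emeasure_\<Omega>: "emeasure lborel \<Omega> = 1"
proof -
  have "emeasure lborel \<Omega> = emeasure lborel {0<..<r} + emeasure lborel {a<..<a + 1 - r}"
    unfolding \<Omega>_def using r_le_a by (intro plus_emeasure[symmetric]) auto
  also have "\<dots> = ennreal r + ennreal (1 - r)"
    using r_pos r_le_half by simp
  also have "\<dots> = 1"
    using r_pos r_le_half by (simp flip: ennreal_plus)
  finally show ?thesis .
qed

lemma lmeasurable_\<Omega>: "\<Omega> \<in> lmeasurable"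
  using measure_lebesgue_on_eq_1(1)[OF _ emeasure_\<Omega>] open_\<Omega> by simp

lemma LINT_wave_eq_0_iff:
  assumes "\<nu> \<noteq> 0"
  shows "(LINT x|lebesgue_on \<Omega>. wave \<nu> x) = 0
      \<longleftrightarrow> wave \<nu> r + wave \<nu> (a + 1 - r) = 1 + wave \<nu> a"
proof -
  have "(wave \<nu> has_integral (wave \<nu> r - wave \<nu> 0) / (2 * of_real pi * \<i> * of_real \<nu>)
      + (wave \<nu> (a + 1 - r) - wave \<nu> a) / (2 * of_real pi * \<i> * of_real \<nu>)) \<Omega>"
    unfolding \<Omega>_def
  proof (rule has_integral_Un)
    have "{0<..<r} \<inter> {a<..<a + 1 - r} = {}" using r_le_a by auto
    then show "negligible ({0<..<r} \<inter> {a<..<a + 1 - r})" by simp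
  qed (use r_pos r_le_half in \<open>auto intro!: has_integral_wave_interval[OF assms] simp del: wave_0\<close>)
  moreover have "(wave \<nu> has_integral (LINT x|lebesgue_on \<Omega>. wave \<nu> x)) \<Omega>"
    using lmeasurable_\<Omega> by (intro has_integral_integral_lebesgue_on integrable_wave) auto
  ultimately have "(LINT x|lebesgue_on \<Omega>. wave \<nu> x)
      = (wave \<nu> r - wave \<nu> 0) / (2 * of_real pi * \<i> * of_real \<nu>)
      + (wave \<nu> (a + 1 - r) - wave \<nu> a) / (2 * of_real pi * \<i> * of_real \<nu>)"
    by (rule has_integral_unique[rotated])
  also have "\<dots> = (wave \<nu> r + wave \<nu> (a + 1 - r) - (1 + wave \<nu> a)) / (2 * of_real pi * \<i> * of_real \<nu>)"
    by (simp add: diff_divide_distrib add_divide_distrib)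
  finally have "(LINT x|lebesgue_on \<Omega>. wave \<nu> x)
      = (wave \<nu> r + wave \<nu> (a + 1 - r) - (1 + wave \<nu> a)) / (2 * of_real pi * \<i> * of_real \<nu>)" .
  then show ?thesis using assms by simp
qed

text \<open>
  In the three cases of \<open>unit_sum_eq_cases\<close> the factor $e_\nu(1)$ is recovered from
  $e_\nu(a+1-r)\,e_\nu(r) = e_\nu(a)\,e_\nu(1)$; it equals 1 in the first two.
\<close>

lemma spectrum_frequencies:
  assumes sp: "is_spectrum \<Omega> \<Lambda>" and "\<alpha> \<in> \<Lambda>" "\<beta> \<in> \<Lambda>" "\<alpha> \<noteq> \<beta>"
  shows "\<alpha> - \<beta> \<in> \<int> \<and> ((\<alpha> - \<beta>) * r \<in> \<int> \<or> (\<alpha> - \<beta>) * (a - r) \<in> \<int>)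
      \<or> (\<alpha> - \<beta>) * a - 1 / 2 \<in> \<int>"
proof -
  define \<nu> where "\<nu> = \<alpha> - \<beta>"
  have "(LINT x|lebesgue_on \<Omega>. wave \<nu> x) = 0"
    using spectrum_orthogonal[OF assms] by (simp add: L2_inner_def wave_mult_cnj \<nu>_def)
  then have "wave \<nu> r + wave \<nu> (a + 1 - r) = 1 + wave \<nu> a"
    using LINT_wave_eq_0_iff \<open>\<alpha> \<noteq> \<beta>\<close> by (simp add: \<nu>_def)
  then consider "wave \<nu> r = 1" "wave \<nu> (a + 1 - r) = wave \<nu> a"
    | "wave \<nu> r = wave \<nu> a" "wave \<nu> (a + 1 - r) = 1" | "wave \<nu> a = -1"
    using unit_sum_eq_cases[of "wave \<nu> r" "wave \<nu> (a + 1 - r)" "wave \<nu> a"] by auto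
  then show ?thesis
  proof cases
    case 1
    have "wave \<nu> (a + 1 - r) * wave \<nu> r = wave \<nu> a * wave \<nu> 1"
      by (simp flip: wave_add)
    then have "wave \<nu> 1 = 1" using 1 by simp
    then show ?thesis using 1 by (simp add: wave_eq_1_iff \<nu>_def)
  next
    case 2
    have "wave \<nu> (a + 1 - r) * wave \<nu> r = wave \<nu> a * wave \<nu> 1"
      by (simp flip: wave_add)
    then have "wave \<nu> 1 = 1" using 2 by simp
    moreover have "wave \<nu> (a - r) * wave \<nu> r = wave \<nu> a"
      by (simp flip: wave_add)
    then have "wave \<nu> (a - r) = 1" using 2 by simp
    ultimately show ?thesis by (simp add: wave_eq_1_iff \<nu>_def)
  next
    case 3
    then show ?thesis by (simp add: wave_eq_minus_1_iff \<nu>_def)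
  qed
qed

text \<open>
  Translating $(a, a+1-r)$ by the integer $r - a$ gives $(r, 1)$, so $\Omega$ represents
  $\mathbb{R}/\mathbb{Z}$ up to finitely many points, and Fourier series on $[0, 1]$ apply.
\<close>

lemma spectrum_integers:
  assumes "a - r \<in> \<int>"
  shows "is_spectrum \<Omega> \<int>"
proof -
  have int_mult: "of_int k * (a - r) \<in> \<int>" for k :: int
    using assms by simp
  have wave_shift: "wave (of_int k) (y + (a - r)) = wave (of_int k) y" for k :: int and y
    using int_mult[of k] by (simp add: wave_add wave_eq_1_iff)
  have "is_spectrum \<Omega> (range (of_int :: int \<Rightarrow> real))"
  proof (rule is_spectrumI[OF open_\<Omega> emeasure_\<Omega>])
    fix j k :: int assume "j \<noteq> k"
    have "wave (of_int (j - k)) a = wave (of_int (j - k)) r"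
      using wave_shift[of "j - k" r] by simp
    moreover have "wave (of_int (j - k)) (a + 1 - r) = 1"
      using wave_shift[of "j - k" 1] by (simp add: wave_eq_1_iff algebra_simps)
    ultimately show "(LINT x|lebesgue_on \<Omega>. wave (of_int j - of_int k) x) = 0"
      using \<open>j \<noteq> k\<close> LINT_wave_eq_0_iff[of "of_int (j - k)"] by simp
  next
    fix h :: "real \<Rightarrow> complex" and \<epsilon> :: real
    assume h: "continuous_on UNIV h" and h0: "\<And>x. x \<notin> \<Omega> \<Longrightarrow> h x = 0" and "\<epsilon> > 0"
    \<comment> \<open>The two pieces fit together continuously because $h$ vanishes at all four endpoints.\<close>
    define h' where "h' y = (if y \<le> r then h y else h (y + (a - r)))" for y
    have zeros: "h 0 = 0" "h r = 0" "h a = 0" "h (a + 1 - r) = 0"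
      using r_pos r_le_a r_le_half by (auto intro!: h0 simp: \<Omega>_def)
    have "continuous_on {0..1} h'"
      unfolding h'_def
      by (intro continuous_on_cases_le continuous_on_compose2[OF h] continuous_intros)
         (use zeros in auto)
    moreover have "h' 0 = h' 1"
      using zeros r_pos r_le_half by (simp add: h'_def add_diff_eq add.commute)
    ultimately obtain K c where K: "finite K"
      and near: "\<And>y. y \<in> {0..1} \<Longrightarrow> cmod (h' y - (\<Sum>k\<in>K. c k * wave (of_int k / 1) y)) < \<epsilon>"
      using uniform_trig_approx[OF zero_less_one _ _ \<open>\<epsilon> > 0\<close>] by blast
    have "cmod (h x - (\<Sum>k\<in>K. c k * wave (of_int k) x)) \<le> \<epsilon>" if "x \<in> \<Omega>" for x
    proof (cases "x \<in> {0<..<r}")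
      case True
      then show ?thesis using near[of x] r_le_half by (simp add: h'_def less_imp_le)
    next
      case False
      then have "x \<in> {a<..<a + 1 - r}" using that by (auto simp: \<Omega>_def)
      then show ?thesis
        using near[of "x - (a - r)"] r_pos wave_shift[of _ "x - (a - r)"]
        by (simp add: h'_def less_imp_le)
    qed
    then show "\<exists>K c. finite K \<and> (\<forall>x\<in>\<Omega>. cmod (h x - (\<Sum>k\<in>K. c k * wave (of_int k) x)) \<le> \<epsilon>)"
      using K by blast
  qed (auto intro: injI)
  then show ?thesis by (simp add: Ints_def)
qed

text \<open>
  The integers $k$ for which $(0, r) + k$ meets $(a, a+1-r)$ are those in the open interval
  $(a-r, a-r+1)$. It contains an integer unless $a - r$ is one, and then $1_J - 1_{J+k}$ contradicts
  completeness for $J$ the part of $(0, r)$ that $k$ moves into $(a, a+1-r)$.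
\<close>

lemma spectrum_imp_diff_int:
  assumes sp: "is_spectrum \<Omega> \<Lambda>" and int: "\<Lambda> \<subseteq> \<int>"
  shows "a - r \<in> \<int>"
proof (rule ccontr)
  assume non_int: "a - r \<notin> \<int>"
  define k :: real where "k = of_int \<lceil>a - r\<rceil>"
  have "k \<in> \<int>" by (simp add: k_def)
  then have "k \<noteq> a - r" using non_int by metis
  then have k: "a - r < k" "k < a - r + 1"
    using ceiling_correct[of "a - r"] unfolding k_def by linarith+
  define u v where "u = max 0 (a - k)" and "v = min r (a + 1 - r - k)"
  have "u < v" using k r_pos r_le_half by (auto simp: u_def v_def)
  have "(if (0::real) = 0 then 1 else -1::complex) = 0"
  proof (rule spectrum_no_shift_relation[OF sp \<open>u < v\<close>, of "{0, k}" "\<lambda>d. if d = 0 then 1 else -1"])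
    have k0: "k > 0" using k r_le_a by linarith
    show "{u + d<..<v + d} \<subseteq> \<Omega>" if "d \<in> {0, k}" for d
      using that by (auto simp: \<Omega>_def u_def v_def)
    show "{u + d<..<v + d} \<inter> {u + d'<..<v + d'} = {}"
      if "d \<in> {0, k}" "d' \<in> {0, k}" "d \<noteq> d'" for d d'
    proof -
      have "v \<le> u + k" using r_le_a by (auto simp: u_def v_def)
      then show ?thesis using that by auto
    qed
    show "(\<Sum>d\<in>{0, k}. (if d = 0 then 1 else -1) * wave \<alpha> d) = 0" if "\<alpha> \<in> \<Lambda>" for \<alpha>
    proof -
      have "wave \<alpha> k = 1"
        using that int \<open>k \<in> \<int>\<close> by (auto simp: wave_eq_1_iff intro!: Ints_mult)
      then show ?thesis using k0 by simp
    qed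
  qed auto
  then show False by simp
qed

text \<open>
  With $r = \frac12$, the integral of $e_\nu$ over $\Omega$ is
  $(1 + e_\nu(a)) \int_0^{1/2} e_\nu$, which vanishes for two reasons: differences inside one
  coset are even integers and kill the second factor, differences between the cosets have
  $e_\nu(a) = -1$. For the approximation, $h$ is split into $A(y) = \frac12(h(y) + h(y+a))$ and
  $\frac12(h(y) - h(y+a)) = e_\theta(y) B(y)$. Both $A$ and $B$ vanish at the ends of
  $[0, \frac12]$ and have uniform approximations $P'$ and $Q'$ with frequencies in $2\mathbb{Z}$;
  since $e_\theta(a) = -1$ and $P'$, $Q'$ have period $a$, the sum $P' + e_\theta Q'$ is close to
  $h$ on both intervals.
\<close>

lemma spectrum_alternating:
  assumes r_half: "r = 1 / 2" and a_eq: "a = of_int n / 2" and "odd p"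
  shows "is_spectrum \<Omega> (alternating_frequencies p n)"
proof -
  have "n > 0" using a_eq r_pos r_le_a by (simp add: zero_less_divide_iff)
  have \<Omega>_half: "x \<in> \<Omega> \<longleftrightarrow> x \<in> {0<..<1/2} \<or> x \<in> {a<..<a + 1/2}" for x
    unfolding \<Omega>_def using r_half by auto
  define \<theta> where "\<theta> = real_of_int p / of_int n"
  have \<theta>n: "\<theta> * of_int n = of_int p" using \<open>n > 0\<close> by (simp add: \<theta>_def)
  \<comment> \<open>Even indices run through the even integers, odd ones through the other coset.\<close>
  define \<mu> :: "int \<Rightarrow> real" where
    "\<mu> k = (if even k then of_int k else \<theta> + of_int (k - 1))" for k
  have \<mu>_even: "\<mu> (2 * m) = 2 * of_int m" and \<mu>_odd: "\<mu> (2 * m + 1) = \<theta> + 2 * of_int m" for m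
    by (simp_all add: \<mu>_def)
  have range_\<mu>: "range \<mu> = alternating_frequencies p n"
  proof -
    have "range \<mu> = range (\<lambda>m. \<mu> (2 * m)) \<union> range (\<lambda>m. \<mu> (2 * m + 1))"
      by (auto simp: image_iff) (metis evenE oddE)
    then show ?thesis by (simp add: \<mu>_even \<mu>_odd alternating_frequencies_def \<theta>_def)
  qed
  have wave_a_even: "wave (2 * of_int m) a = 1" for m :: int
    by (simp add: wave_eq_1_iff a_eq)
  have wave_a_\<theta>: "wave \<theta> a = -1"
  proof -
    obtain s where "p = 2 * s + 1" using \<open>odd p\<close> by (rule oddE)
    then have "\<theta> * a - 1 / 2 = of_int s" using \<theta>n by (simp add: a_eq field_simps)
    then show ?thesis by (simp add: wave_eq_minus_1_iff)
  qed
  have wave_a_odd: "wave (\<theta> + 2 * of_int m) a = -1" for m :: int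
    by (simp add: wave_add_freq wave_a_\<theta> wave_a_even)
  have wave_\<mu>_a: "wave (\<mu> k) a = (if even k then 1 else -1)" for k
  proof (cases "even k")
    case True
    then obtain m where "k = 2 * m" by (rule evenE)
    then show ?thesis by (simp only: \<mu>_even wave_a_even) simp
  next
    case False
    then obtain m where "k = 2 * m + 1" by (rule oddE)
    then show ?thesis by (simp only: \<mu>_odd wave_a_odd) simp
  qed
  have inner: "(LINT x|lebesgue_on \<Omega>. wave \<nu> x) = 0" if "\<nu> \<noteq> 0" "wave \<nu> (1/2) = 1 \<or> wave \<nu> a = -1" for \<nu>
  proof -
    have "a + 1 - r = a + r" by (simp add: r_half)
    then have "wave \<nu> (a + 1 - r) = wave \<nu> a * wave \<nu> r"
      by (simp only: wave_add)
    moreover have "wave \<nu> r = 1 \<or> wave \<nu> a = -1"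
      using that(2) by (simp only: r_half)
    ultimately show ?thesis
      unfolding LINT_wave_eq_0_iff[OF that(1)] by auto
  qed
  have parity_cases: "(\<mu> j - \<mu> k) \<noteq> 0 \<and> (wave (\<mu> j - \<mu> k) (1/2) = 1 \<or> wave (\<mu> j - \<mu> k) a = -1)"
    if "j \<noteq> k" for j k
  proof (cases "even j = even k")
    case True
    then have "even (j - k)" by simp
    then obtain m where m: "j - k = 2 * m" by (rule evenE)
    have "\<mu> j - \<mu> k = of_int (j - k)" using True by (auto simp: \<mu>_def)
    then have "\<mu> j - \<mu> k = 2 * of_int m" using m by simp
    moreover have "m \<noteq> 0" using that m by auto
    ultimately show ?thesis by (simp add: wave_eq_1_iff)
  next
    case False
    have "wave (\<mu> j - \<mu> k) a = wave (\<mu> j) a * cnj (wave (\<mu> k) a)"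
      by (simp add: wave_mult_cnj)
    also have "\<dots> = -1"
      using False by (auto simp: wave_\<mu>_a)
    finally have "wave (\<mu> j - \<mu> k) a = -1" .
    moreover from this have "\<mu> j - \<mu> k \<noteq> 0" by auto
    ultimately show ?thesis by blast
  qed
  have "is_spectrum \<Omega> (range \<mu>)"
  proof (rule is_spectrumI[OF open_\<Omega> emeasure_\<Omega>])
    show "inj \<mu>" using parity_cases by (metis injI right_minus_eq)
    show "(LINT x|lebesgue_on \<Omega>. wave (\<mu> j - \<mu> k) x) = 0" if "j \<noteq> k" for j k
      using parity_cases[OF that] inner by blast
  next
    fix h :: "real \<Rightarrow> complex" and \<epsilon> :: real
    assume h: "continuous_on UNIV h" and h0: "\<And>x. x \<notin> \<Omega> \<Longrightarrow> h x = 0" and "\<epsilon> > 0"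
    have zeros: "h 0 = 0" "h (1 / 2) = 0" "h a = 0" "h (a + 1 / 2) = 0" "h (1 / 2 + a) = 0"
      using r_pos r_le_a r_half by (auto intro!: h0 simp: \<Omega>_half)
    define A where "A y = (h y + h (y + a)) / 2" for y
    define B where "B y = wave (- \<theta>) y * ((h y - h (y + a)) / 2)" for y
    have cont: "continuous_on {0..1/2} A" "continuous_on {0..1/2} B"
      unfolding A_def B_def
      by (intro continuous_intros continuous_on_compose2[OF h]; simp)+
    have ends: "A 0 = A (1/2)" "B 0 = B (1/2)" using zeros by (simp_all add: A_def B_def)
    have half: "(0::real) < 1 / 2" "\<epsilon> / 2 > 0" using \<open>\<epsilon> > 0\<close> by simp_all
    obtain K c where K: "finite K"
      and P: "\<And>y. y \<in> {0..1/2} \<Longrightarrow> cmod (A y - (\<Sum>k\<in>K. c k * wave (of_int k / (1/2)) y)) < \<epsilon> / 2"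
      using uniform_trig_approx[OF half(1) cont(1) ends(1) half(2)] by blast
    obtain L d where L: "finite L"
      and Q: "\<And>y. y \<in> {0..1/2} \<Longrightarrow> cmod (B y - (\<Sum>k\<in>L. d k * wave (of_int k / (1/2)) y)) < \<epsilon> / 2"
      using uniform_trig_approx[OF half(1) cont(2) ends(2) half(2)] by blast
    define P' where "P' y = (\<Sum>k\<in>K. c k * wave (2 * of_int k) y)" for y
    define Q' where "Q' y = (\<Sum>k\<in>L. d k * wave (2 * of_int k) y)" for y
    have near: "cmod (A y - P' y) + cmod (B y - Q' y) \<le> \<epsilon>" if "y \<in> {0..1/2}" for y
      using P[OF that] Q[OF that] by (simp add: P'_def Q'_def mult.commute)
    have P'_shift: "P' (y + a) = P' y" and Q'_shift: "Q' (y + a) = Q' y" for y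
      by (simp_all add: P'_def Q'_def wave_add wave_a_even)
    have close: "cmod (h x - (P' x + wave \<theta> x * Q' x)) \<le> \<epsilon>" if "x \<in> \<Omega>" for x
    proof -
      have AB: "wave \<theta> y * B y = (h y - h (y + a)) / 2" for y
        using wave_add_freq[of \<theta> "- \<theta>" y] by (simp add: B_def)
      show ?thesis
      proof (cases "x \<in> {0<..<1/2}")
        case True
        have "h x = A x + wave \<theta> x * B x" unfolding AB by (simp add: A_def field_simps)
        then have "h x - (P' x + wave \<theta> x * Q' x) = (A x - P' x) + wave \<theta> x * (B x - Q' x)"
          by (simp add: algebra_simps)
        also have "cmod \<dots> \<le> cmod (A x - P' x) + cmod (B x - Q' x)"
          by (rule norm_triangle_le) (simp add: norm_mult)
        finally show ?thesis using near[of x] True by simp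
      next
        case False
        define y where "y = x - a"
        have y: "y \<in> {0..1/2}" and x: "x = y + a"
          using False that by (auto simp: \<Omega>_half y_def)
        have "h x = A y - wave \<theta> y * B y" unfolding AB x by (simp add: A_def field_simps)
        moreover have "wave \<theta> x = - wave \<theta> y" by (simp add: x wave_add wave_a_\<theta>)
        ultimately have "h x - (P' x + wave \<theta> x * Q' x) = (A y - P' y) - wave \<theta> y * (B y - Q' y)"
          using P'_shift[of y, folded x] Q'_shift[of y, folded x] by (simp add: algebra_simps)
        also have "cmod \<dots> \<le> cmod (A y - P' y) + cmod (wave \<theta> y * (B y - Q' y))"
          by (rule norm_triangle_ineq4)
        finally show ?thesis using near[OF y] by (simp add: norm_mult)
      qed
    qed
    define b where "b j = (if even j then c (j div 2) else d (j div 2))" for j :: int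
    define M where "M = (\<lambda>k. 2 * k) ` K \<union> (\<lambda>k. 2 * k + 1) ` L"
    have "(\<Sum>j\<in>M. b j * wave (\<mu> j) x) = P' x + wave \<theta> x * Q' x" for x
    proof -
      have "(\<Sum>j\<in>M. b j * wave (\<mu> j) x)
          = (\<Sum>j\<in>(\<lambda>k. 2 * k) ` K. b j * wave (\<mu> j) x) + (\<Sum>j\<in>(\<lambda>k. 2 * k + 1) ` L. b j * wave (\<mu> j) x)"
        unfolding M_def using K L by (intro sum.union_disjoint) (auto, presburger)
      also have "(\<Sum>j\<in>(\<lambda>k. 2 * k) ` K. b j * wave (\<mu> j) x) = P' x"
        by (subst sum.reindex) (auto simp: inj_on_def b_def \<mu>_even P'_def)
      also have "(\<Sum>j\<in>(\<lambda>k. 2 * k + 1) ` L. b j * wave (\<mu> j) x) = wave \<theta> x * Q' x"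
        by (subst sum.reindex)
          (auto simp: inj_on_def b_def \<mu>_odd Q'_def wave_add_freq sum_distrib_left intro!: sum.cong)
      finally show ?thesis .
    qed
    moreover have "finite M" using K L by (simp add: M_def)
    ultimately show "\<exists>K c. finite K \<and> (\<forall>x\<in>\<Omega>. cmod (h x - (\<Sum>k\<in>K. c k * wave (\<mu> k) x)) \<le> \<epsilon>)"
      using close by (intro exI[of _ M] exI[of _ b]) simp
  qed
  then show ?thesis by (simp only: range_\<mu>)
qed

text \<open>
  A non-integral difference $\nu$ satisfies $\nu a \in \frac12 + \mathbb{Z}$. Subtracting two
  such relations, for $\alpha - \theta$ and $\theta$ when $\alpha$ is an integer and for $\alpha$
  and $\theta$ otherwise, shows that $\alpha a$, respectively $(\alpha - \theta) a$, is an integer.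
  A difference with this property is not in the half-integer case, and in the remaining cases it lies
  in $G$.
\<close>

lemma spectrum_coset_structure:
  assumes sp: "is_spectrum \<Omega> \<Lambda>" and "0 \<in> \<Lambda>" and \<theta>: "\<theta> \<in> \<Lambda>" "\<theta> \<notin> \<int>"
  defines "G \<equiv> {m::int. of_int m * a \<in> \<int> \<and> of_int m * r \<in> \<int>}"
  shows "\<theta> * a - 1 / 2 \<in> \<int>"
    and "\<Lambda> \<subseteq> of_int ` G \<union> (\<lambda>m. \<theta> + of_int m) ` G"
proof -
  note freq = spectrum_frequencies[OF sp]
  have half: "(\<alpha> - \<beta>) * a - 1 / 2 \<in> \<int>" if "\<alpha> \<in> \<Lambda>" "\<beta> \<in> \<Lambda>" "\<alpha> - \<beta> \<notin> \<int>" for \<alpha> \<beta>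
    using freq[of \<alpha> \<beta>] that by fastforce
  show \<theta>a: "\<theta> * a - 1 / 2 \<in> \<int>"
    using half[OF \<theta>(1) \<open>0 \<in> \<Lambda>\<close>] \<theta>(2) by simp
  have half_notin: "(1 / 2 :: real) \<notin> \<int>"
    by (auto elim!: Ints_cases simp: field_simps)
  have G: "\<exists>m\<in>G. \<alpha> - \<beta> = of_int m" if "\<alpha> \<in> \<Lambda>" "\<beta> \<in> \<Lambda>" "(\<alpha> - \<beta>) * a \<in> \<int>" for \<alpha> \<beta>
  proof (cases "\<alpha> = \<beta>")
    case True
    then show ?thesis by (intro bexI[of _ 0]) (auto simp: G_def)
  next
    case False
    have not_half: "(\<alpha> - \<beta>) * a - 1 / 2 \<notin> \<int>"
    proof
      assume "(\<alpha> - \<beta>) * a - 1 / 2 \<in> \<int>"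
      from Ints_diff[OF that(3) this] show False using half_notin by simp
    qed
    then have *: "\<alpha> - \<beta> \<in> \<int>" "(\<alpha> - \<beta>) * r \<in> \<int> \<or> (\<alpha> - \<beta>) * (a - r) \<in> \<int>"
      using freq[of \<alpha> \<beta>] that False by auto
    have "(\<alpha> - \<beta>) * r \<in> \<int>"
      using *(2)
    proof
      assume "(\<alpha> - \<beta>) * (a - r) \<in> \<int>"
      from Ints_diff[OF that(3) this] show ?thesis by (simp add: algebra_simps)
    qed
    then show ?thesis using *(1) that(3) by (auto simp: G_def elim!: Ints_cases)
  qed
  show "\<Lambda> \<subseteq> of_int ` G \<union> (\<lambda>m. \<theta> + of_int m) ` G"
  proof
    fix \<alpha> assume \<alpha>: "\<alpha> \<in> \<Lambda>"
    show "\<alpha> \<in> of_int ` G \<union> (\<lambda>m. \<theta> + of_int m) ` G"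
    proof (cases "\<alpha> \<in> \<int>")
      case True
      then have "\<alpha> - \<theta> \<notin> \<int>" using \<theta>(2) Ints_diff[of \<alpha> "\<alpha> - \<theta>"] by auto
      then have "(\<alpha> - \<theta>) * a - 1 / 2 \<in> \<int>" using half \<alpha> \<theta> by blast
      from Ints_add[OF this \<theta>a] have "\<alpha> * a - 1 \<in> \<int>" by (simp add: algebra_simps)
      from Ints_add[OF this Ints_1] have "(\<alpha> - 0) * a \<in> \<int>" by simp
      then show ?thesis using G[OF \<alpha> \<open>0 \<in> \<Lambda>\<close>] by auto
    next
      case False
      then have "(\<alpha> - 0) * a - 1 / 2 \<in> \<int>" using half[OF \<alpha> \<open>0 \<in> \<Lambda>\<close>] by simp
      from Ints_diff[OF this \<theta>a] have "(\<alpha> - \<theta>) * a \<in> \<int>" by (simp add: algebra_simps)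
      then obtain m where "m \<in> G" "\<alpha> - \<theta> = of_int m" using G[OF \<alpha> \<theta>(1)] by blast
      then have "\<alpha> = \<theta> + of_int m" by simp
      then show ?thesis using \<open>m \<in> G\<close> by blast
    qed
  qed
qed

text \<open>
  $G$ is a nonzero group because $\Lambda$ is infinite, so $G = q\mathbb{Z}$, $r = s/q$ and
  $a = t/q$ with $2s \le q$. For $q \ge 3$ the second interval has length at least $2/q$, and
  with $l = 1/q$ the translates of $(0, l)$ by $0$, $a$ and $a + l$ are disjoint subintervals of
  $\Omega$.
\<close>

lemma spectrum_nonintegral:
  assumes sp: "is_spectrum \<Omega> \<Lambda>" and "0 \<in> \<Lambda>" and \<theta>: "\<theta> \<in> \<Lambda>" "\<theta> \<notin> \<int>"
  shows "r = 1 / 2 \<and> (\<exists>n p. a = of_int n / 2 \<and> odd p \<and> \<Lambda> = alternating_frequencies p n)"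
proof -
  define G where "G = {m::int. of_int m * a \<in> \<int> \<and> of_int m * r \<in> \<int>}"
  note struct = spectrum_coset_structure[OF assms, folded G_def]
  have "infinite \<Lambda>"
    using sp by (rule is_spectrumE) (auto dest: finite_imageD)
  have "\<exists>z\<in>G. z \<noteq> 0"
  proof (rule ccontr)
    assume "\<not> ?thesis"
    then have "G \<subseteq> {0}" by blast
    then have "finite G" by (rule finite_subset) simp
    then have "finite \<Lambda>" using struct(2) by (meson finite_UnI finite_imageI finite_subset)
    then show False using \<open>infinite \<Lambda>\<close> by simp
  qed
  then obtain z where "z \<in> G" "z \<noteq> 0" by blast
  moreover have "x - y \<in> G" if "x \<in> G" "y \<in> G" for x y
    using that by (auto simp: G_def left_diff_distrib)
  ultimately obtain q where "q > 0" "q \<in> G" and q_dvd: "\<And>x. x \<in> G \<Longrightarrow> q dvd x"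
    using subgroup_of_int_generator by blast
  obtain s t where s: "of_int q * r = of_int s" and t: "of_int q * a = of_int t"
    using \<open>q \<in> G\<close> by (auto simp: G_def elim!: Ints_cases)
  have cosets: "(\<exists>m::int. \<alpha> = of_int (q * m)) \<or> (\<exists>m::int. \<alpha> = \<theta> + of_int (q * m))" if \<alpha>: "\<alpha> \<in> \<Lambda>" for \<alpha>
  proof -
    obtain x where "x \<in> G" and x: "\<alpha> = of_int x \<or> \<alpha> = \<theta> + of_int x"
      using struct(2) \<alpha> by blast
    then obtain m where "x = q * m" using q_dvd by blast
    then show ?thesis using x by blast
  qed
  have s_pos: "s > 0"
  proof -
    have "of_int q * r > 0" using \<open>q > 0\<close> r_pos by simp
    then show ?thesis unfolding s by simp
  qed
  have s_le: "2 * s \<le> q"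
  proof -
    have "of_int q * r \<le> of_int q * (1 / 2)"
      using \<open>q > 0\<close> r_le_half by (intro mult_left_mono) auto
    then show ?thesis unfolding s by simp
  qed
  have r_eq: "r = of_int s / of_int q" and a_eq: "a = of_int t / of_int q"
    using s t \<open>q > 0\<close> by (simp_all add: field_simps)
  have "q \<le> 2"
  proof (rule ccontr)
    assume "\<not> q \<le> 2"
    then have q3: "s + 2 \<le> q" using s_pos s_le by linarith
    define l where "l = 1 / real_of_int q"
    have l: "l > 0" "l \<le> r" "2 * l \<le> 1 - r"
      using \<open>q > 0\<close> s_pos q3 by (auto simp: l_def r_eq field_simps simp flip: of_int_add)
    define w where "w = wave \<theta> (a + l)"
    \<comment> \<open>The cross product of the vectors of factors $(1, 1, 1)$ and $(1, -1, w)$ of the two cosets.\<close>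
    define c where "c d = (if d = 0 then w + 1 else if d = a then 1 - w else -2)" for d :: real
    have "c (a + l) = 0"
    proof (rule spectrum_no_shift_relation[OF sp l(1), of "{0, a, a + l}"])
      show "{0 + d<..<l + d} \<subseteq> \<Omega>" if "d \<in> {0, a, a + l}" for d
        using that l by (auto simp: \<Omega>_def)
      show "{0 + d<..<l + d} \<inter> {0 + d'<..<l + d'} = {}"
        if "d \<in> {0, a, a + l}" "d' \<in> {0, a, a + l}" "d \<noteq> d'" for d d'
        using that l r_le_a by auto
      show "(\<Sum>d\<in>{0, a, a + l}. c d * wave \<alpha> d) = 0" if "\<alpha> \<in> \<Lambda>" for \<alpha>
      proof -
        have sum: "(\<Sum>d\<in>{0, a, a + l}. c d * wave \<alpha> d) = w + 1 + (1 - w) * wave \<alpha> a - 2 * wave \<alpha> (a + l)"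
          using l r_le_a r_pos by (simp add: c_def)
        have q_int: "wave (of_int (q * m)) a = 1" "wave (of_int (q * m)) (a + l) = 1" for m
        proof -
          have "of_int (q * m) * a = of_int (m * t)" using t by simp
          then show 1: "wave (of_int (q * m)) a = 1" by (simp only: wave_eq_1_iff) simp
          have "of_int (q * m) * l = of_int m" using \<open>q > 0\<close> by (simp add: l_def)
          then have "wave (of_int (q * m)) l = 1" by (simp only: wave_eq_1_iff) simp
          then show "wave (of_int (q * m)) (a + l) = 1" using 1 by (simp only: wave_add) simp
        qed
        have \<theta>a: "wave \<theta> a = -1" using struct(1) by (simp add: wave_eq_minus_1_iff)
        from cosets[OF that] show ?thesis
        proof (elim disjE exE)
          fix m assume "\<alpha> = of_int (q * m)"
          then show ?thesis unfolding sum by (simp only: q_int) simp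
        next
          fix m assume "\<alpha> = \<theta> + of_int (q * m)"
          then show ?thesis unfolding sum
            by (simp only: wave_add_freq q_int \<theta>a flip: w_def) (simp add: algebra_simps)
        qed
      qed
    qed auto
    then show False using l r_le_a r_pos by (simp add: c_def)
  qed
  then have q2: "q = 2" and s1: "s = 1" using s_pos s_le by linarith+
  have r_half: "r = 1 / 2" and a_half: "a = of_int t / 2" using r_eq a_eq q2 s1 by simp_all
  obtain j :: int where j: "\<theta> * a - 1 / 2 = of_int j"
    using struct(1) by (rule Ints_cases)
  define p where "p = 2 * j + 1"
  have "odd p" by (simp add: p_def)
  have "t > 0" using a_half r_pos r_le_a by (simp add: zero_less_divide_iff)
  have "\<theta> = of_int p / of_int t"
    using j a_half \<open>t > 0\<close> by (simp add: p_def field_simps)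
  then have \<theta>_eq: "\<theta> + of_int (q * m) = of_int p / of_int t + 2 * of_int m" for m
    by (simp add: q2)
  have "\<Lambda> \<subseteq> alternating_frequencies p t"
  proof
    fix \<alpha> assume "\<alpha> \<in> \<Lambda>"
    then consider m where "\<alpha> = of_int (q * m)" | m where "\<alpha> = \<theta> + of_int (q * m)"
      using cosets by blast
    then show "\<alpha> \<in> alternating_frequencies p t"
      unfolding \<theta>_eq by cases (auto simp: alternating_frequencies_def q2)
  qed
  then have "\<Lambda> = alternating_frequencies p t"
    using spectrum_subset_imp_eq[OF sp spectrum_alternating[OF r_half a_half \<open>odd p\<close>]] by blast
  then show ?thesis using r_half a_half \<open>odd p\<close> by blast
qed

end

theorem theorem1p1:
  fixes r a :: real and \<Omega> \<Lambda> :: "real set"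
  assumes "0 < r" and "r \<le> 1/2" and "a \<ge> r"
    and "\<Omega> = {0<..<r} \<union> {a<..<a + 1 - r}"
  shows "(is_spectrum \<Omega> \<Lambda> \<and> 0 \<in> \<Lambda> \<longrightarrow>
            (a - r \<in> \<int> \<and> \<Lambda> = \<int>) \<or>
            (r = 1/2 \<and> (\<exists>n::int. a = of_int n / 2 \<and>
               (\<exists>p::int. odd p \<and>
                  \<Lambda> = range (\<lambda>m::int. 2 * of_int m)
                      \<union> range (\<lambda>m::int. of_int p / of_int n + 2 * of_int m)))))
         \<and>
         ((a - r \<in> \<int> \<and> \<Lambda> = \<int>) \<or>
          (r = 1/2 \<and> (\<exists>n::int. a = of_int n / 2 \<and>
             (\<exists>p::int. odd p \<and>
                \<Lambda> = range (\<lambda>m::int. 2 * of_int m)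
                    \<union> range (\<lambda>m::int. of_int p / of_int n + 2 * of_int m))))
          \<longrightarrow> is_spectrum \<Omega> \<Lambda>)"
proof -
  interpret I: two_intervals r a
    using assms(1-3) by unfold_locales
  have \<Omega>: "\<Omega> = I.\<Omega>" using assms(4) by (simp add: I.\<Omega>_def)
  show ?thesis
    unfolding \<Omega> alternating_frequencies_def[symmetric]
  proof (intro conjI impI; elim conjE disjE exE)
    assume sp: "is_spectrum I.\<Omega> \<Lambda>" and zero: "0 \<in> \<Lambda>"
    show "(a - r \<in> \<int> \<and> \<Lambda> = \<int>) \<or> (r = 1/2 \<and> (\<exists>n. a = of_int n / 2 \<and>
        (\<exists>p. odd p \<and> \<Lambda> = alternating_frequencies p n)))"
    proof (cases "\<Lambda> \<subseteq> \<int>")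
      case True
      then have "a - r \<in> \<int>" by (rule I.spectrum_imp_diff_int[OF sp])
      then show ?thesis
        using spectrum_subset_imp_eq[OF sp I.spectrum_integers True] by blast
    next
      case False
      then show ?thesis using I.spectrum_nonintegral[OF sp zero] by blast
    qed
  next
    assume "a - r \<in> \<int>" "\<Lambda> = \<int>"
    then show "is_spectrum I.\<Omega> \<Lambda>" using I.spectrum_integers by blast
  next
    fix n p :: int
    assume "r = 1/2" "a = of_int n / 2" "odd p" "\<Lambda> = alternating_frequencies p n"
    then show "is_spectrum I.\<Omega> \<Lambda>" using I.spectrum_alternating by blast
  qed
qed

end
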